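(* For $\rho\ge1/\sin(1/2)$ let $\alpha=\arcsin(1/\rho)$, $v=(2\cos\alpha-\cos2\alpha)\csc2\alpha$, $$\overline\beta(\rho)=\arctan\left(\frac{-v+\sqrt{v^2-\left(\tfrac94\cos^2\alpha-1\right)\left(\tfrac54-v^2\right)}}{\tfrac94\cos^2\alpha-1}\right),\qquad \overline\gamma(\rho)=\arccos\left(\tfrac43\cos(\alpha+\overline\beta(\rho))\right),$$ and let $\mathcal R^\rho_\infty(\overline\beta,\overline\gamma)$ denote the expected rendezvous time of $\infty$-$\mathrm{RB}_{\overline\beta(\rho),\overline\gamma(\rho)}$ in $\mathrm{SRD}^\rho$. Then $$\lim_{\rho\to\infty}\frac{\pi/2-\overline\beta(\rho)}{\arcsin(1/\rho)}=5,\qquad \lim_{\rho\to\infty}\frac{\pi/2-\overline\gamma(\rho)}{\arcsin(1/\rho)}=\frac{16}3,$$ and $$\lim_{\rho\to\infty}\rho^2\left(5-\mathcal R^\rho_\infty(\overline\beta,\overline\gamma)\right)=\frac{289}6.$$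
   Context: Symmetric Rendezvous in a Disk, $\mathrm{SRD}^\rho$ ($\rho>\sqrt2$): two robots start on a circle of radius $\rho$ centred at a known reference point $O$, at Euclidean distance $2$; each knows $O$, $\rho$ and the distance but not which of the two possible positions is the peer's. Robots move with speed at most $1$, run the same synchronized randomized algorithm with independent random bits, and meet only when at the same point at the same time. Set $\alpha=\arcsin(1/\rho)$, so the robots are at angular distance $2\alpha$ as seen from $O$. Moves: for a robot at $A$ with $|OA|=r>0$, a direction (clockwise/counterclockwise), an angle $\phi\in\{\alpha,2\alpha\}$ and $\theta\in[0,\pi/2)$, let $L$ be the ray from $O$ obtained by rotating ray $OA$ by $\phi$ in that direction; the robot walks straight from $A$ to the point $P\in L$ with $\angle OAP=\theta$ ($P=O$ if $\theta=0$). A $\beta$-darting is this move with $\phi=\alpha,\theta=\beta$; a random $\beta$-darting uses an independent fair coin for the direction. A $\gamma$-darting in the opposite direction is the move with $\phi=2\alpha,\theta=\gamma$ in the direction opposite to the one just used. Algorithm $\infty$-$\mathrm{RB}_{\beta,\gamma}$: repeat forever: a random $\beta$-darting, then a $\gamma$-darting in the opposite direction; robots stop upon meeting. *)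

theory Defs
  imports "HOL-Probability.Probability"
begin

text \<open>
  The plane is \<^typ>\<open>complex\<close> and the reference point \<open>O\<close> is \<open>0\<close>.
\<close>

definition srd_instance :: "real \<Rightarrow> complex \<Rightarrow> complex \<Rightarrow> bool" where
  "srd_instance \<rho> A B \<longleftrightarrow> norm A = \<rho> \<and> norm B = \<rho> \<and> dist A B = 2"

definition vertex_angle :: "complex \<Rightarrow> complex \<Rightarrow> complex \<Rightarrow> real" where
  "vertex_angle P Q R = arccos (((P - Q) \<bullet> (R - Q)) / (norm (P - Q) * norm (R - Q)))"

text \<open>
  A direction is a Boolean, \<^const>\<open>True\<close> standing for counterclockwise.
\<close>

definition rotated_ray :: "complex \<Rightarrow> bool \<Rightarrow> real \<Rightarrow> complex set" where
  "rotated_ray A d \<phi> = {t *\<^sub>R (A * cis (if d then \<phi> else - \<phi>)) | t. 0 \<le> t}"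

text \<open>
  For \<open>A \<noteq> 0\<close>, \<open>0 < \<phi>\<close>, \<open>0 \<le> \<theta>\<close> and \<open>\<phi> + \<theta> < \<pi>\<close> the point described
  below exists and is unique. The ray contains its apex \<open>O\<close>, and the angle at \<open>A\<close> from \<open>O\<close>
  to \<open>O\<close> is \<open>0\<close>, so that \<open>\<theta> = 0\<close> yields the point \<open>O\<close>.
\<close>

definition dart :: "complex \<Rightarrow> bool \<Rightarrow> real \<Rightarrow> real \<Rightarrow> complex" where
  "dart A d \<phi> \<theta> = (THE P. P \<in> rotated_ray A d \<phi> \<and> vertex_angle 0 A P = \<theta>)"

text \<open>
  The turning points of a robot that starts at \<open>A\<close> and never stops, where \<open>c k\<close> is the
  outcome of its coin in round \<open>k\<close>. A round consists of two legs.
\<close>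

fun waypoint :: "real \<Rightarrow> real \<Rightarrow> real \<Rightarrow> complex \<Rightarrow> (nat \<Rightarrow> bool) \<Rightarrow> nat \<Rightarrow> complex" where
  "waypoint \<alpha> \<beta> \<gamma> A c 0 = A"
| "waypoint \<alpha> \<beta> \<gamma> A c (Suc n) =
     (if even n then dart (waypoint \<alpha> \<beta> \<gamma> A c n) (c (n div 2)) \<alpha> \<beta>
      else dart (waypoint \<alpha> \<beta> \<gamma> A c n) (\<not> c (n div 2)) (2 * \<alpha>) \<gamma>)"

definition arrival_time :: "(nat \<Rightarrow> complex) \<Rightarrow> nat \<Rightarrow> real" where
  "arrival_time W n = (\<Sum>k<n. dist (W k) (W (Suc k)))"

text \<open>
  \<open>robot_at W t P\<close>: a robot walking at unit speed along the polygonal path \<open>W\<close> is at the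
  point \<open>P\<close> at time \<open>t\<close>. No position is assigned once infinitely many legs have been
  walked in finite time; robots starting at the same distance from \<open>O\<close> get there without
  having met only if their coins agree in every round, an event of probability \<open>0\<close>.
\<close>

definition robot_at :: "(nat \<Rightarrow> complex) \<Rightarrow> real \<Rightarrow> complex \<Rightarrow> bool" where
  "robot_at W t P \<longleftrightarrow>
     (\<exists>n. arrival_time W n \<le> t \<and> t \<le> arrival_time W (Suc n) \<and>
          P \<in> closed_segment (W n) (W (Suc n)) \<and> dist (W n) P = t - arrival_time W n)"

text \<open>
  Stopping upon meeting is accounted for by taking the first time at which the two unstopped
  robots meet; the value is \<open>\<infinity>\<close> if they never do.
\<close>

definition meeting_time :: "(nat \<Rightarrow> complex) \<Rightarrow> (nat \<Rightarrow> complex) \<Rightarrow> ennreal" where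
  "meeting_time V W = Inf {ennreal t | t. \<exists>P. robot_at V t P \<and> robot_at W t P}"

definition fair_coins :: "(nat \<Rightarrow> bool) measure" where
  "fair_coins = Pi\<^sub>M UNIV (\<lambda>_. measure_pmf (bernoulli_pmf (1/2)))"

definition expected_rendezvous_time ::
    "real \<Rightarrow> real \<Rightarrow> real \<Rightarrow> complex \<Rightarrow> complex \<Rightarrow> ennreal" where
  "expected_rendezvous_time \<rho> \<beta> \<gamma> A B =
     (\<integral>\<^sup>+ (c, d). meeting_time (waypoint (arcsin (1 / \<rho>)) \<beta> \<gamma> A c)
                              (waypoint (arcsin (1 / \<rho>)) \<beta> \<gamma> B d)
        \<partial>(fair_coins \<Otimes>\<^sub>M fair_coins))"

definition beta_bar :: "real \<Rightarrow> real" where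
  "beta_bar \<rho> =
     (let \<alpha> = arcsin (1 / \<rho>);
          v = (2 * cos \<alpha> - cos (2 * \<alpha>)) * (1 / sin (2 * \<alpha>));
          D = 9/4 * (cos \<alpha>)\<^sup>2 - 1
      in arctan ((- v + sqrt (v\<^sup>2 - D * (5/4 - v\<^sup>2))) / D))"

definition gamma_bar :: "real \<Rightarrow> real" where
  "gamma_bar \<rho> = arccos (4/3 * cos (arcsin (1 / \<rho>) + beta_bar \<rho>))"

end

theory Submission
  imports Defs "HOL-Real_Asymp.Real_Asymp"
begin

text \<open>
  As long as the two robots make the same choices, their configuration is the initial one, rotated
  and shrunk by a constant factor \<open>q\<close> per round. In the first round in which they choose differently
  they move as mirror images of each other, and they meet at the end of the first leg when they
  face each other, at the end of the second leg otherwise. With legs of lengths \<open>\<rho> t\<^sub>1\<close> and \<open>\<rho> t\<^sub>2\<close> in the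
  first round the expected time is therefore \<open>\<rho> (t\<^sub>1 + 3/4 t\<^sub>2) / (1 - q/2)\<close>. Writing
  \<open>\<beta> = \<pi>/2 - \<delta>\<close> and \<open>\<gamma> = \<pi>/2 - \<eta>\<close>, all quantities in this formula are cosines of angles that are
  \<open>O(\<alpha>)\<close>, so the limits of \<open>\<delta>/\<alpha>\<close> and \<open>\<eta>/\<alpha>\<close> determine its expansion to second order.
\<close>

subsection \<open>Polygonal paths and darts\<close>

text \<open>Multiplication by \<open>A\<close> is a similarity, so the triangle \<open>0\<close>,
  \<open>A\<close>, \<open>P\<close> may be replaced by \<open>0\<close>, \<open>1\<close>,
  \<open>t *\<^sub>R cis \<psi>\<close>.\<close>

lemma vertex_angle_ray:
  assumes "A \<noteq> 0"
  shows "vertex_angle 0 A (t *\<^sub>R (A * cis \<psi>)) = arccos ((1 - t * cos \<psi>) / norm (1 - t *\<^sub>R cis \<psi>))"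
proof -
  have diff: "t *\<^sub>R (A * cis \<psi>) - A = - (A * (1 - t *\<^sub>R cis \<psi>))"
    by (simp add: algebra_simps)
  have "(0 - A) \<bullet> (t *\<^sub>R (A * cis \<psi>) - A) = (norm A)\<^sup>2 * (1 - t * cos \<psi>)"
    unfolding diff by (simp add: inner_complex_def cmod_power2) algebra
  moreover have "norm (0 - A) * norm (t *\<^sub>R (A * cis \<psi>) - A) = (norm A)\<^sup>2 * norm (1 - t *\<^sub>R cis \<psi>)"
    unfolding diff by (simp add: norm_mult power2_eq_square)
  ultimately show ?thesis
    using assms by (simp add: vertex_angle_def)
qed

lemma norm_one_minus_cis: "norm (1 - t *\<^sub>R cis \<psi>) = sqrt ((1 - t * cos \<psi>)\<^sup>2 + (t * sin \<psi>)\<^sup>2)"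
  by (simp add: cmod_def)

text \<open>In the triangle with \<open>|OA| = 1\<close> and angles \<phi> at \<open>O\<close> and
  \<theta> at \<open>A\<close>, the sine rule gives
  \<open>|OP| = sin \<theta> / sin (\<phi> + \<theta>)\<close> and
  \<open>|AP| = sin \<phi> / sin (\<phi> + \<theta>)\<close>. The projections of these sides onto
  \<open>OA\<close> add up to 1.\<close>

lemma sine_rule_parts:
  fixes \<phi> \<theta> :: real
  assumes "sin (\<phi> + \<theta>) > 0"
  shows "1 - sin \<theta> / sin (\<phi> + \<theta>) * cos \<phi> = sin \<phi> / sin (\<phi> + \<theta>) * cos \<theta>"
proof -
  have "sin (\<phi> + \<theta>) - sin \<theta> * cos \<phi> = sin \<phi> * cos \<theta>"
    by (simp add: sin_add)
  then show ?thesis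
    using assms by (simp add: field_simps)
qed

text \<open>Along and across \<open>OA\<close>, the side \<open>AP\<close> has components
  \<open>s * cos \<theta>\<close> and, up to sign, \<open>s * sin \<theta>\<close>, so its length is
  \<open>s\<close>.\<close>

lemma norm_one_minus_sine_rule:
  fixes \<phi> \<theta> :: real
  assumes "sin (\<phi> + \<theta>) > 0" "sin \<phi> > 0" "\<psi> = \<phi> \<or> \<psi> = - \<phi>"
  shows "norm (1 - (sin \<theta> / sin (\<phi> + \<theta>)) *\<^sub>R cis \<psi>) = sin \<phi> / sin (\<phi> + \<theta>)"
proof -
  define s where "s = sin \<phi> / sin (\<phi> + \<theta>)"
  have "(1 - sin \<theta> / sin (\<phi> + \<theta>) * cos \<psi>)\<^sup>2 + (sin \<theta> / sin (\<phi> + \<theta>) * sin \<psi>)\<^sup>2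
      = (s * cos \<theta>)\<^sup>2 + (s * sin \<theta>)\<^sup>2"
    using assms(3) sine_rule_parts[OF assms(1)] by (auto simp: s_def mult.commute)
  also have "\<dots> = s\<^sup>2"
    by (simp add: power_mult_distrib flip: distrib_left)
  finally have "norm (1 - (sin \<theta> / sin (\<phi> + \<theta>)) *\<^sub>R cis \<psi>) = \<bar>s\<bar>"
    unfolding norm_one_minus_cis by simp
  also have "\<dots> = s"
    using assms by (simp add: s_def)
  finally show ?thesis by (simp add: s_def)
qed

text \<open>The sine rule shows that this point has the required angle; uniqueness on the ray comes
  from recovering \<open>t\<close> from the angle at \<open>A\<close>.\<close>

lemma dart_eq:
  assumes "A \<noteq> 0" "0 < \<phi>" "0 < \<theta>" "\<phi> + \<theta> < pi"
  shows "dart A d \<phi> \<theta> = A * (sin \<theta> / sin (\<phi> + \<theta>)) *\<^sub>R cis (if d then \<phi> else - \<phi>)"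
proof -
  define \<psi> where "\<psi> = (if d then \<phi> else - \<phi>)"
  define m where "m = sin \<theta> / sin (\<phi> + \<theta>)"
  have pos: "sin (\<phi> + \<theta>) > 0" "sin \<phi> > 0" "sin \<theta> > 0"
    using assms by (auto intro!: sin_gt_zero)
  have \<psi>: "\<psi> = \<phi> \<or> \<psi> = - \<phi>" and cos_\<psi>: "cos \<psi> = cos \<phi>" and sin_\<psi>: "(sin \<psi>)\<^sup>2 = (sin \<phi>)\<^sup>2"
    by (auto simp: \<psi>_def)
  have angle: "vertex_angle 0 A (t *\<^sub>R (A * cis \<psi>)) = \<theta> \<longleftrightarrow> t = m" if "0 \<le> t" for t
  proof
    assume "t = m"
    then have "(1 - t * cos \<psi>) / norm (1 - t *\<^sub>R cis \<psi>) = cos \<theta>"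
      using norm_one_minus_sine_rule[OF pos(1,2) \<psi>] sine_rule_parts[OF pos(1)] pos cos_\<psi>
      by (simp add: m_def)
    then show "vertex_angle 0 A (t *\<^sub>R (A * cis \<psi>)) = \<theta>"
      using assms by (simp add: vertex_angle_ray arccos_cos)
  next
    assume eq: "vertex_angle 0 A (t *\<^sub>R (A * cis \<psi>)) = \<theta>"
    define n where "n = norm (1 - t *\<^sub>R cis \<psi>)"
    have n2: "n\<^sup>2 = (1 - t * cos \<phi>)\<^sup>2 + (t * sin \<phi>)\<^sup>2"
      by (simp add: n_def norm_one_minus_cis cos_\<psi> power_mult_distrib sin_\<psi>)
    \<comment> \<open>This bound and \<open>n > 0\<close> put the quotient between -1 and 1, where
      \<open>cos\<close> undoes \<open>arccos\<close>.\<close>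
    have "\<bar>1 - t * cos \<phi>\<bar> \<le> n"
      using abs_Re_le_cmod[of "1 - t *\<^sub>R cis \<psi>"] by (simp add: n_def cos_\<psi>)
    moreover have "n > 0"
    proof (rule ccontr)
      assume "\<not> n > 0"
      then have "n = 0" by (simp add: n_def)
      then have "t * sin \<phi> = 0" "1 - t * cos \<phi> = 0"
        using n2 by (simp_all add: sum_power2_eq_zero_iff)
      then show False using pos by auto
    qed
    ultimately have "\<bar>(1 - t * cos \<phi>) / n\<bar> \<le> 1"
      by simp
    then have "cos \<theta> = (1 - t * cos \<phi>) / n"
      using eq assms(1) cos_arccos_abs by (metis vertex_angle_ray n_def cos_\<psi>)
    then have c: "n * cos \<theta> = 1 - t * cos \<phi>"
      using \<open>n > 0\<close> by simp
    \<comment> \<open>Both \<open>n * sin \<theta>\<close> and \<open>t * sin \<phi>\<close> are the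
      height of the point above \<open>OA\<close>; they are nonnegative, so equal squares
      suffice.\<close>
    have "(n * sin \<theta>)\<^sup>2 = n\<^sup>2 - (n * cos \<theta>)\<^sup>2"
      by (simp add: power_mult_distrib cos_squared_eq algebra_simps)
    also have "\<dots> = (t * sin \<phi>)\<^sup>2"
      unfolding c n2 by simp
    finally have s: "n * sin \<theta> = t * sin \<phi>"
      using \<open>n > 0\<close> pos \<open>0 \<le> t\<close> by (simp add: power2_eq_iff_nonneg)
    have "n * sin \<theta> * cos \<theta> = sin \<theta> * (1 - t * cos \<phi>)"
      using c by algebra
    then have "t * sin (\<phi> + \<theta>) = sin \<theta>"
      unfolding s sin_add by (simp add: algebra_simps)
    then show "t = m"
      using pos by (simp add: m_def field_simps)
  qed
  have "m \<ge> 0"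
    using pos by (simp add: m_def)
  then have "dart A d \<phi> \<theta> = m *\<^sub>R (A * cis \<psi>)"
    unfolding dart_def rotated_ray_def \<psi>_def[symmetric] using angle by (intro the_equality) auto
  then show ?thesis
    by (simp add: m_def \<psi>_def)
qed

section \<open>Meetings on polygonal paths with equal leg lengths\<close>

lemma robot_at_strict:
  assumes "robot_at W t P" "\<And>n. dist (W n) (W (Suc n)) > 0"
  obtains n where "arrival_time W n \<le> t" "t < arrival_time W (Suc n)"
    "P = W n + ((t - arrival_time W n) / dist (W n) (W (Suc n))) *\<^sub>R (W (Suc n) - W n)"
proof -
  obtain n where n: "arrival_time W n \<le> t" "t \<le> arrival_time W (Suc n)"
      "P \<in> closed_segment (W n) (W (Suc n))" "dist (W n) P = t - arrival_time W n"
    using assms(1) by (auto simp: robot_at_def)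
  obtain u where u: "0 \<le> u" "P = W n + u *\<^sub>R (W (Suc n) - W n)"
    using n(3) by (auto simp: in_segment algebra_simps)
  have "t - arrival_time W n = u * dist (W n) (W (Suc n))"
    using n(4) u by (simp add: dist_norm norm_minus_commute)
  then have u_eq: "u = (t - arrival_time W n) / dist (W n) (W (Suc n))"
    using assms(2)[of n] by simp
  \<comment> \<open>At a turning time two legs qualify. Choosing the later one makes the time
    interval of a leg half-open, so that \<open>t\<close> determines the leg.\<close>
  show ?thesis
  proof (cases "t = arrival_time W (Suc n)")
    case False
    with n u show ?thesis by (intro that[of n]) (auto simp: u_eq)
  next
    case True
    then have "u = 1"
      unfolding u_eq using assms(2)[of n] by (auto simp: arrival_time_def)
    then show ?thesis
      using u True assms(2)[of "Suc n"] by (intro that[of "Suc n"]) (auto simp: arrival_time_def)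
  qed
qed

text \<open>Equal leg lengths give equal arrival times, so before time
  \<open>arrival_time V N\<close> a common position would be reached on the same leg at the same
  fraction \<open>u\<close>, which \<open>apart\<close> excludes.\<close>

lemma meeting_time_eq:
  assumes pos: "\<And>n. dist (V n) (V (Suc n)) > 0"
    and same: "\<And>n. dist (W n) (W (Suc n)) = dist (V n) (V (Suc n))"
    and meet: "V N = W N"
    and apart: "\<And>n u. n < N \<Longrightarrow> 0 \<le> u \<Longrightarrow> u < 1 \<Longrightarrow>
      V n + u *\<^sub>R (V (Suc n) - V n) \<noteq> W n + u *\<^sub>R (W (Suc n) - W n)"
  shows "meeting_time V W = ennreal (arrival_time V N)"
proof -
  have arr: "arrival_time W = arrival_time V"
    by (simp add: arrival_time_def same fun_eq_iff)
  have mono: "strict_mono (arrival_time V)"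
    using pos by (auto simp: strict_mono_Suc_iff arrival_time_def)
  have "arrival_time V N \<le> t" if t: "robot_at V t P" "robot_at W t P" for t P
  proof (rule ccontr)
    assume less: "\<not> arrival_time V N \<le> t"
    obtain n where n: "arrival_time V n \<le> t" "t < arrival_time V (Suc n)"
        "P = V n + ((t - arrival_time V n) / dist (V n) (V (Suc n))) *\<^sub>R (V (Suc n) - V n)"
      using robot_at_strict[OF t(1) pos] .
    obtain m where m: "arrival_time V m \<le> t" "t < arrival_time V (Suc m)"
        "P = W m + ((t - arrival_time V m) / dist (V m) (V (Suc m))) *\<^sub>R (W (Suc m) - W m)"
      using robot_at_strict[OF t(2)] pos unfolding same arr by metis
    have "n < Suc m" "m < Suc n" "n < N"
      using n m less strict_mono_less[OF mono, of n "Suc m"] strict_mono_less[OF mono, of m "Suc n"]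
        strict_mono_less[OF mono, of n N] by linarith+
    then have "n = m" by simp
    define u where "u = (t - arrival_time V n) / dist (V n) (V (Suc n))"
    have "0 \<le> u" "u < 1"
      using n pos[of n] by (auto simp: u_def arrival_time_def field_simps)
    with apart[OF \<open>n < N\<close>] n(3) m(3) show False
      unfolding \<open>n = m\<close> u_def by metis
  qed
  moreover have "robot_at V (arrival_time V N) (V N)" "robot_at W (arrival_time V N) (V N)"
    unfolding robot_at_def arr using strict_mono_leD[OF mono, of N "Suc N"]
    by (auto simp: meet intro!: exI[of _ N])
  ultimately show ?thesis
    unfolding meeting_time_def by (intro antisym Inf_lower Inf_greatest) (auto intro!: ennreal_leI)
qed

lemma meeting_time_commute: "meeting_time V W = meeting_time W V"
  unfolding meeting_time_def by (simp add: conj_commute)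

section \<open>Scaling and rotation along one run of the algorithm\<close>

locale darting =
  fixes \<alpha> \<beta> \<gamma> :: real
  assumes \<alpha>: "0 < \<alpha>" "2 * \<alpha> < pi" and \<beta>: "0 < \<beta>" "\<alpha> + \<beta> < pi" and \<gamma>: "0 < \<gamma>" "2 * \<alpha> + \<gamma> < pi"
begin

definition turn :: "nat \<Rightarrow> real" where
  "turn n = (if even n then \<alpha> else 2 * \<alpha>)"

definition incline :: "nat \<Rightarrow> real" where
  "incline n = (if even n then \<beta> else \<gamma>)"

text \<open>By the sine rule, this is the factor by which the distance from \<open>O\<close> changes
  on leg \<open>n\<close>; \<open>stretch n\<close> is the length of the leg in units of the
  distance at its start.\<close>

definition scale :: "nat \<Rightarrow> real" where
  "scale n = sin (incline n) / sin (turn n + incline n)"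

definition stretch :: "nat \<Rightarrow> real" where
  "stretch n = sin (turn n) / sin (turn n + incline n)"

text \<open>Counterclockwise is positive. The second leg of a round, where \<open>n\<close> is odd,
  goes against the coin, hence the comparison with \<open>even n\<close>.\<close>

definition signed_turn :: "(nat \<Rightarrow> bool) \<Rightarrow> nat \<Rightarrow> real" where
  "signed_turn c n = (if c (n div 2) = even n then turn n else - turn n)"

definition radius :: "nat \<Rightarrow> real" where
  "radius n = (\<Prod>k<n. scale k)"

lemma sin_pos: "sin (turn n) > 0" "sin (incline n) > 0" "sin (turn n + incline n) > 0"
  using \<alpha> \<beta> \<gamma> by (auto simp: turn_def incline_def intro!: sin_gt_zero)

lemma scale_pos: "scale n > 0" and stretch_pos: "stretch n > 0"
  using sin_pos[of n] by (auto simp: scale_def stretch_def)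

lemma radius_pos: "radius n > 0"
  by (auto simp: radius_def scale_pos intro!: prod_pos)

text \<open>\<open>dart_eq\<close> applies only away from \<open>O\<close>. The positive scale
  factor of each leg keeps the robot away from it, so both claims come from one step.\<close>

lemma waypoint_ne_0: "A \<noteq> 0 \<Longrightarrow> waypoint \<alpha> \<beta> \<gamma> A c n \<noteq> 0"
  and waypoint_Suc: "A \<noteq> 0 \<Longrightarrow> waypoint \<alpha> \<beta> \<gamma> A c (Suc n) =
    waypoint \<alpha> \<beta> \<gamma> A c n * scale n *\<^sub>R cis (signed_turn c n)"
proof -
  have step: "waypoint \<alpha> \<beta> \<gamma> A c (Suc n) =
      waypoint \<alpha> \<beta> \<gamma> A c n * scale n *\<^sub>R cis (signed_turn c n)"
    if "waypoint \<alpha> \<beta> \<gamma> A c n \<noteq> 0" for n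
    using that \<alpha> \<beta> \<gamma> by (auto simp: dart_eq scale_def signed_turn_def turn_def incline_def)
  show *: "A \<noteq> 0 \<Longrightarrow> waypoint \<alpha> \<beta> \<gamma> A c n \<noteq> 0" for n
  proof (induction n)
    case (Suc n)
    then show ?case using scale_pos[of n] by (simp add: step del: waypoint.simps(2))
  qed simp
  show "A \<noteq> 0 \<Longrightarrow> waypoint \<alpha> \<beta> \<gamma> A c (Suc n) =
    waypoint \<alpha> \<beta> \<gamma> A c n * scale n *\<^sub>R cis (signed_turn c n)"
    by (intro step *)
qed

declare waypoint.simps(2) [simp del]

lemma norm_waypoint: "A \<noteq> 0 \<Longrightarrow> norm (waypoint \<alpha> \<beta> \<gamma> A c n) = norm A * radius n"
proof (induction n)
  case (Suc n)
  then show ?case using scale_pos[of n] by (simp add: waypoint_Suc norm_mult radius_def)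
qed (simp add: radius_def)

lemma dist_waypoint:
  assumes "A \<noteq> 0"
  shows "dist (waypoint \<alpha> \<beta> \<gamma> A c n) (waypoint \<alpha> \<beta> \<gamma> A c (Suc n)) = norm A * radius n * stretch n"
proof -
  have "dist (waypoint \<alpha> \<beta> \<gamma> A c n) (waypoint \<alpha> \<beta> \<gamma> A c (Suc n))
      = norm (waypoint \<alpha> \<beta> \<gamma> A c n * (1 - scale n *\<^sub>R cis (signed_turn c n)))"
    by (simp add: dist_norm waypoint_Suc[OF assms] algebra_simps)
  also have "\<dots> = norm A * radius n * stretch n"
    unfolding norm_mult norm_waypoint[OF assms] scale_def stretch_def
    by (subst norm_one_minus_sine_rule) (auto simp: sin_pos signed_turn_def)
  finally show ?thesis .
qed

text \<open>Multiplying the start of leg \<open>n\<close> by this factor gives the position after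
  the fraction \<open>u\<close> of the leg, \<sigma> being its signed turn.\<close>

definition progress :: "nat \<Rightarrow> real \<Rightarrow> real \<Rightarrow> complex" where
  "progress n u \<sigma> = of_real (1 - u) + of_real (u * scale n) * cis \<sigma>"

lemma waypoint_progress:
  assumes "A \<noteq> 0"
  shows "waypoint \<alpha> \<beta> \<gamma> A c n + u *\<^sub>R (waypoint \<alpha> \<beta> \<gamma> A c (Suc n) - waypoint \<alpha> \<beta> \<gamma> A c n)
    = waypoint \<alpha> \<beta> \<gamma> A c n * progress n u (signed_turn c n)"
  by (simp add: waypoint_Suc[OF assms] progress_def scaleR_conv_of_real algebra_simps)

text \<open>The leg turns by an angle with nonzero sine, so its line misses \<open>O\<close>. Hence
  positions on two copies of the leg that differ by a proper rotation never coincide.\<close>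

lemma progress_ne_0: "progress n u (signed_turn c n) \<noteq> 0"
proof
  assume *: "progress n u (signed_turn c n) = 0"
  have "u * scale n * sin (signed_turn c n) = 0"
    using arg_cong[OF *, of Im] by (simp add: progress_def)
  then have "u = 0"
    using scale_pos[of n] sin_pos(1)[of n] by (auto simp: signed_turn_def split: if_splits)
  with * show False by (simp add: progress_def)
qed

text \<open>On legs in opposite directions the two positions are mirror images in the bisector of the
  angle between them, so the robots meet only on that bisector.\<close>

lemma opposing_legs_apart:
  assumes "V \<noteq> 0" "0 \<le> u" "u < 1" "sin \<psi> > 0" "sin (\<psi> - \<sigma>) \<ge> 0"
  shows "V * progress n u \<sigma> \<noteq> V * cis (2 * \<psi>) * progress n u (- \<sigma>)"
proof
  assume "V * progress n u \<sigma> = V * cis (2 * \<psi>) * progress n u (- \<sigma>)"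
  \<comment> \<open>After cancelling \<open>V\<close> and rotating by \<open>- \<psi>\<close>, the
    bisector is the real axis and the two positions are complex conjugates, so equality makes the
    imaginary parts vanish.\<close>
  then have "cis (- \<psi>) * progress n u \<sigma> = cis (- \<psi>) * (cis (2 * \<psi>) * progress n u (- \<sigma>))"
    using assms(1) by simp
  also have "\<dots> = cis \<psi> * progress n u (- \<sigma>)"
    by (simp add: cis_mult flip: mult.assoc)
  finally have "Im (cis (- \<psi>) * progress n u \<sigma>) = Im (cis \<psi> * progress n u (- \<sigma>))"
    by simp
  then have "(1 - u) * sin \<psi> + u * scale n * sin (\<psi> - \<sigma>) = 0"
    by (simp add: progress_def sin_diff algebra_simps)
  \<comment> \<open>Strictness comes from \<open>u < 1\<close>: with
    \<open>sin (\<psi> - \<sigma>) = 0\<close> the robots do meet at the end of the leg.\<close>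
  moreover have "(1 - u) * sin \<psi> > 0" "u * scale n * sin (\<psi> - \<sigma>) \<ge> 0"
    using assms scale_pos[of n] by auto
  ultimately show False by linarith
qed

section \<open>Two robots whose coins agree before round \<open>k\<close>\<close>

context
  fixes A :: complex and c d :: "nat \<Rightarrow> bool" and k :: nat
  assumes A: "A \<noteq> 0" and agree: "\<And>i. i < k \<Longrightarrow> c i = d i"
begin

lemma waypoint_agree:
  "n \<le> 2 * k \<Longrightarrow> waypoint \<alpha> \<beta> \<gamma> (A * cis \<psi>) d n = waypoint \<alpha> \<beta> \<gamma> A c n * cis \<psi>"
proof (induction n)
  case (Suc n)
  then have "signed_turn d n = signed_turn c n"
    using agree[of "n div 2"] by (simp add: signed_turn_def)
  with Suc show ?case by (simp add: waypoint_Suc A mult_ac)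
qed simp

text \<open>The second robot is ahead counterclockwise by 2\<alpha>. In round \<open>k\<close> this
  gap closes on the first leg if \<open>c k\<close> holds; otherwise it widens to 4\<alpha> and
  closes on the second leg, where both turn back by 2\<alpha>.\<close>

lemma meeting_time_waypoint:
  assumes differ: "c k \<noteq> d k"
  shows "meeting_time (waypoint \<alpha> \<beta> \<gamma> A c) (waypoint \<alpha> \<beta> \<gamma> (A * cis (2 * \<alpha>)) d)
    = ennreal (arrival_time (waypoint \<alpha> \<beta> \<gamma> A c) (if c k then 2 * k + 1 else 2 * k + 2))"
proof -
  define N where "N = (if c k then 2 * k + 1 else 2 * k + 2)"
  define V where "V = waypoint \<alpha> \<beta> \<gamma> A c"
  define W where "W = waypoint \<alpha> \<beta> \<gamma> (A * cis (2 * \<alpha>)) d"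
  have B: "A * cis (2 * \<alpha>) \<noteq> 0" using A by simp
  have V_ne_0: "V n \<noteq> 0" for n
    by (simp add: V_def waypoint_ne_0 A)
  have V_Suc: "V (Suc n) = V n * scale n *\<^sub>R cis (signed_turn c n)"
    and W_Suc: "W (Suc n) = W n * scale n *\<^sub>R cis (signed_turn d n)" for n
    by (simp_all only: V_def W_def waypoint_Suc[OF A] waypoint_Suc[OF B])
  have W_agree: "W n = V n * cis (2 * \<alpha>)" if "n \<le> 2 * k" for n
    using waypoint_agree[OF that] by (simp add: V_def W_def)
  have W_apart: "W (2 * k + 1) = V (2 * k + 1) * cis (2 * (2 * \<alpha>))" if "\<not> c k"
    using that differ W_agree[of "2 * k"]
    by (simp add: V_Suc W_Suc signed_turn_def turn_def cis_mult)
  have signed: "signed_turn d n = - signed_turn c n" if "n div 2 = k" for n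
    using differ that by (auto simp: signed_turn_def)
  have "V N = W N"
  proof (cases "c k")
    case True
    with W_agree[of "2 * k"] show ?thesis
      using differ by (simp add: N_def V_Suc W_Suc signed_turn_def turn_def cis_mult)
  next
    case False
    with W_apart show ?thesis
      using differ V_Suc[of "2 * k + 1"] W_Suc[of "2 * k + 1"]
      by (simp add: N_def signed_turn_def turn_def cis_mult)
  qed
  moreover have "V n + u *\<^sub>R (V (Suc n) - V n) \<noteq> W n + u *\<^sub>R (W (Suc n) - W n)"
    if n: "n < N" and u: "0 \<le> u" "u < 1" for n u
  proof -
    have sin: "sin \<alpha> > 0" "sin (2 * \<alpha>) > 0"
      using \<alpha> by (auto intro!: sin_gt_zero)
    \<comment> \<open>In agreeing rounds the positions differ by the rotation
      \<open>cis (2 * \<alpha>)\<close>; on the two legs of round \<open>k\<close> they are mirror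
      images, with half-gap \<psi> equal to \<alpha> and 2\<alpha> at the start.\<close>
    have "V n * progress n u (signed_turn c n) \<noteq> W n * progress n u (signed_turn d n)"
    proof -
      consider "n < 2 * k" | "n = 2 * k" | "n = 2 * k + 1" "\<not> c k"
        using n by (auto simp: N_def split: if_splits) linarith+
      then show ?thesis
      proof cases
        case 1
        then have "signed_turn d n = signed_turn c n"
          using agree[of "n div 2"] by (simp add: signed_turn_def)
        moreover have "cis (2 * \<alpha>) \<noteq> 1"
          using sin by (auto simp: complex_eq_iff)
        ultimately show ?thesis
          using W_agree[of n] 1 V_ne_0[of n] progress_ne_0 by auto
      next
        case 2
        show ?thesis
          unfolding 2 W_agree[of "2 * k", simplified] signed[of "2 * k", simplified]
          using sin V_ne_0 u
          by (intro opposing_legs_apart) (auto simp: signed_turn_def turn_def)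
      next
        case 3
        have "signed_turn d (2 * k + 1) = - signed_turn c (2 * k + 1)"
          by (rule signed) simp
        then show ?thesis
          unfolding 3(1) W_apart[OF 3(2)]
          using 3(2) sin V_ne_0 u
          by (simp only:) (intro opposing_legs_apart, auto simp: signed_turn_def turn_def)
      qed
    qed
    then show ?thesis
      unfolding V_def W_def waypoint_progress[OF A] waypoint_progress[OF B] .
  qed
  moreover have "dist (V n) (V (Suc n)) > 0" "dist (W n) (W (Suc n)) = dist (V n) (V (Suc n))" for n
    using A by (auto simp: V_def W_def dist_waypoint[OF A] dist_waypoint[OF B] norm_mult
      intro!: mult_pos_pos radius_pos stretch_pos)
  ultimately show ?thesis
    unfolding V_def[symmetric] W_def[symmetric] N_def[symmetric] by (intro meeting_time_eq) auto
qed

end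

lemma radius_even: "radius (2 * k) = (scale 0 * scale 1) ^ k"
proof (induction k)
  case (Suc k)
  have "scale (2 * k) = scale 0" "scale (Suc (2 * k)) = scale 1"
    by (simp_all add: scale_def turn_def incline_def)
  with Suc show ?case by (simp add: radius_def)
qed (simp add: radius_def)

lemma arrival_time_even:
  assumes "A \<noteq> 0"
  shows "arrival_time (waypoint \<alpha> \<beta> \<gamma> A c) (2 * k) =
    (\<Sum>j<k. norm A * (scale 0 * scale 1) ^ j * (stretch 0 + scale 0 * stretch 1))"
    and "arrival_time (waypoint \<alpha> \<beta> \<gamma> A c) (2 * k + 1) =
    arrival_time (waypoint \<alpha> \<beta> \<gamma> A c) (2 * k) + norm A * (scale 0 * scale 1) ^ k * stretch 0"
proof -
  have Suc: "arrival_time (waypoint \<alpha> \<beta> \<gamma> A c) (Suc n) =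
      arrival_time (waypoint \<alpha> \<beta> \<gamma> A c) n + norm A * radius n * stretch n" for n
    by (simp add: arrival_time_def dist_waypoint[OF assms])
  have par: "scale (2 * k) = scale 0" "stretch (2 * k) = stretch 0" "stretch (Suc (2 * k)) = stretch 1" for k
    by (simp_all add: scale_def stretch_def turn_def incline_def)
  show odd: "arrival_time (waypoint \<alpha> \<beta> \<gamma> A c) (2 * k + 1) =
      arrival_time (waypoint \<alpha> \<beta> \<gamma> A c) (2 * k) + norm A * (scale 0 * scale 1) ^ k * stretch 0" for k
    by (simp add: Suc par radius_even)
  have Sr: "radius (Suc n) = radius n * scale n" for n
    by (simp add: radius_def)
  show "arrival_time (waypoint \<alpha> \<beta> \<gamma> A c) (2 * k) =
    (\<Sum>j<k. norm A * (scale 0 * scale 1) ^ j * (stretch 0 + scale 0 * stretch 1))"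
  proof (induction k)
    case (Suc k)
    have "arrival_time (waypoint \<alpha> \<beta> \<gamma> A c) (2 * Suc k) =
        arrival_time (waypoint \<alpha> \<beta> \<gamma> A c) (2 * k + 1) + norm A * radius (Suc (2 * k)) * stretch 1"
      using \<open>\<And>n. arrival_time _ (Suc n) = _\<close>[of "2 * k + 1"] by (simp add: par)
    also have "radius (Suc (2 * k)) = (scale 0 * scale 1) ^ k * scale 0"
      by (simp add: Sr radius_even par)
    finally show ?case
      using Suc odd[of k] by (simp add: algebra_simps)
  qed (simp add: arrival_time_def)
qed

end

subsection \<open>Fair coins\<close>

interpretation fair_coins: product_prob_space "\<lambda>_. measure_pmf (bernoulli_pmf (1/2))" "UNIV :: nat set"
  by unfold_locales

lemma prob_space_fair_coins: "prob_space fair_coins"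
  unfolding fair_coins_def by (rule fair_coins.prob_space_axioms)

lemma space_fair_coins [simp]: "space fair_coins = UNIV"
  by (simp add: fair_coins_def space_PiM)

lemma measurable_coin [measurable]: "(\<lambda>c. c i) \<in> measurable fair_coins (count_space UNIV)"
  unfolding fair_coins_def by (rule measurable_compose[OF measurable_component_singleton]) auto

lemma emeasure_fair_coins_prefix: "emeasure fair_coins {c. \<forall>i<k. c i = f i} = ennreal ((1/2) ^ k)"
proof -
  have "emeasure fair_coins {c. \<forall>i<k. c i = f i} =
      emeasure (Pi\<^sub>M UNIV (\<lambda>_. measure_pmf (bernoulli_pmf (1/2))))
        {c \<in> space (Pi\<^sub>M UNIV (\<lambda>_. measure_pmf (bernoulli_pmf (1/2)))). \<forall>i\<in>{..<k}. c i \<in> {f i}}"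
    by (simp add: fair_coins_def space_PiM Ball_def)
  also have "\<dots> = (\<Prod>i<k. emeasure (measure_pmf (bernoulli_pmf (1/2))) {f i})"
    by (rule fair_coins.emeasure_PiM_Collect) auto
  also have "\<dots> = (\<Prod>i<k. ennreal (1/2))"
    by (intro prod.cong) (auto simp: emeasure_pmf_single)
  also have "\<dots> = ennreal ((1/2) ^ k)"
    by (subst prod_ennreal) simp_all
  finally show ?thesis .
qed

section \<open>Probabilities of agreement and of facing each other\<close>

definition agree :: "nat \<Rightarrow> ((nat \<Rightarrow> bool) \<times> (nat \<Rightarrow> bool)) set" where
  "agree k = {(c, d). \<forall>i<k. c i = d i}"

text \<open>\<open>s\<close> stands for the outcome that sends the first robot towards the second.
  It depends on which robot is ahead counterclockwise, so it stays a parameter.\<close>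

definition facing :: "bool \<Rightarrow> nat \<Rightarrow> ((nat \<Rightarrow> bool) \<times> (nat \<Rightarrow> bool)) set" where
  "facing s k = {(c, d). (\<forall>i<k. c i = d i) \<and> c k = s \<and> d k = (\<not> s)}"

lemma sets_agree [measurable]: "agree k \<in> sets (fair_coins \<Otimes>\<^sub>M fair_coins)"
proof -
  have "agree k = {p \<in> space (fair_coins \<Otimes>\<^sub>M fair_coins). \<forall>i<k. fst p i = snd p i}"
    by (auto simp: agree_def space_pair_measure)
  also have "\<dots> \<in> sets (fair_coins \<Otimes>\<^sub>M fair_coins)"
    by measurable
  finally show ?thesis .
qed

lemma sets_facing [measurable]: "facing s k \<in> sets (fair_coins \<Otimes>\<^sub>M fair_coins)"
proof -
  have "facing s k = {p \<in> space (fair_coins \<Otimes>\<^sub>M fair_coins). (\<forall>i<k. fst p i = snd p i) \<and> fst p k = s \<and> snd p k = (\<not> s)}"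
    by (auto simp: facing_def space_pair_measure)
  also have "\<dots> \<in> sets (fair_coins \<Otimes>\<^sub>M fair_coins)"
    by measurable
  finally show ?thesis .
qed

interpretation coins: prob_space fair_coins
  by (rule prob_space_fair_coins)

lemma emeasure_agree: "emeasure (fair_coins \<Otimes>\<^sub>M fair_coins) (agree k) = ennreal ((1/2) ^ k)"
proof -
  have "Pair c -` agree k = {d. \<forall>i<k. d i = c i}" for c
    by (auto simp: agree_def)
  then have "emeasure (fair_coins \<Otimes>\<^sub>M fair_coins) (agree k) = (\<integral>\<^sup>+ c. ennreal ((1/2) ^ k) \<partial>fair_coins)"
    by (subst coins.emeasure_pair_measure_alt) (simp_all add: emeasure_fair_coins_prefix)
  then show ?thesis
    by (simp add: coins.emeasure_space_1[simplified])
qed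

lemma emeasure_facing: "emeasure (fair_coins \<Otimes>\<^sub>M fair_coins) (facing s k) = ennreal ((1/2) ^ k / 4)"
proof -
  have one: "emeasure fair_coins {c. c k = s} = ennreal (1/2)"
  proof -
    have "emeasure fair_coins {c. c k = s} =
        emeasure (Pi\<^sub>M UNIV (\<lambda>_. measure_pmf (bernoulli_pmf (1/2))))
          {c \<in> space (Pi\<^sub>M UNIV (\<lambda>_. measure_pmf (bernoulli_pmf (1/2)))). \<forall>i\<in>{k}. c i \<in> {s}}"
      by (simp add: fair_coins_def space_PiM)
    also have "\<dots> = (\<Prod>i\<in>{k}. emeasure (measure_pmf (bernoulli_pmf (1/2))) {s})"
      by (rule fair_coins.emeasure_PiM_Collect) auto
    finally show ?thesis by (simp add: emeasure_pmf_single)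
  qed
  \<comment> \<open>Given \<open>c k = s\<close>, the first \<open>k + 1\<close> coins of
    \<open>d\<close> are prescribed, the last one being \<open>\<not> s\<close>.\<close>
  have "Pair c -` facing s k = (if c k = s then {d. \<forall>i<Suc k. d i = (c(k := \<not> s)) i} else {})" for c
    by (auto simp: facing_def less_Suc_eq)
  then have "emeasure (fair_coins \<Otimes>\<^sub>M fair_coins) (facing s k)
      = (\<integral>\<^sup>+ c. ennreal ((1/2) ^ Suc k) * indicator {c. c k = s} c \<partial>fair_coins)"
    by (subst coins.emeasure_pair_measure_alt, simp)
      (auto intro!: nn_integral_cong simp: emeasure_fair_coins_prefix simp del: fun_upd_apply power_Suc)
  also have "\<dots> = ennreal ((1/2) ^ Suc k) * ennreal (1/2)"
  proof -
    have "{c \<in> space fair_coins. c k = s} \<in> sets fair_coins"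
      by measurable
    then show ?thesis
      by (subst nn_integral_cmult_indicator) (simp_all add: one)
  qed
  also have "\<dots> = ennreal ((1/2) ^ k / 4)"
    by (subst ennreal_mult[symmetric]) auto
  finally show ?thesis .
qed

text \<open>Everlasting agreement lies in every \<open>agree k\<close>, and these sets have
  probability \<open>(1/2) ^ k\<close>, which tends to 0.\<close>

lemma AE_differ: "AE (c, d) in fair_coins \<Otimes>\<^sub>M fair_coins. c \<noteq> d"
proof (rule AE_I)
  let ?N = "\<Inter>k. agree k"
  show "{p \<in> space (fair_coins \<Otimes>\<^sub>M fair_coins). \<not> (case p of (c, d) \<Rightarrow> c \<noteq> d)} \<subseteq> ?N"
    by (auto simp: agree_def)
  show "?N \<in> sets (fair_coins \<Otimes>\<^sub>M fair_coins)"
    by measurable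
  have "emeasure (fair_coins \<Otimes>\<^sub>M fair_coins) ?N \<le> ennreal ((1/2) ^ k)" for k
    unfolding emeasure_agree[symmetric] by (intro emeasure_mono) auto
  moreover have "(\<lambda>k. ennreal ((1/2) ^ k)) \<longlonglongrightarrow> ennreal 0"
    by (intro tendsto_ennrealI LIMSEQ_power_zero) simp
  ultimately have "emeasure (fair_coins \<Otimes>\<^sub>M fair_coins) ?N \<le> ennreal 0"
    by (intro LIMSEQ_le_const) auto
  then show "emeasure (fair_coins \<Otimes>\<^sub>M fair_coins) ?N = 0" by simp
qed

text \<open>The time is accumulated leg by leg: the first leg of round \<open>k\<close> is walked when the coins have
  agreed so far, the second one unless moreover the robots face each other in round \<open>k\<close>.\<close>

lemma nn_integral_round_time:
  fixes a b q :: real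
  assumes nonneg: "0 \<le> a" "0 \<le> b" "0 \<le> q" "q < 2"
    and T: "\<And>c d k. (\<And>i. i < k \<Longrightarrow> c i = d i) \<Longrightarrow> c k \<noteq> d k \<Longrightarrow>
      T c d = ennreal ((\<Sum>j<k. q ^ j * (a + b)) + q ^ k * a + (if c k = s then 0 else q ^ k * b))"
  shows "(\<integral>\<^sup>+ (c, d). T c d \<partial>(fair_coins \<Otimes>\<^sub>M fair_coins)) = ennreal ((a + 3/4 * b) / (1 - q / 2))"
proof -
  let ?M = "fair_coins \<Otimes>\<^sub>M fair_coins"
  define g where "g k p = ennreal (q ^ k * a) * indicator (agree k) p +
    ennreal (q ^ k * b) * indicator (agree k - facing s k) p" for k p
  have g_meas: "g k \<in> borel_measurable ?M" for k
    unfolding g_def by measurable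
  have T_eq: "T c d = (\<Sum>k. g k (c, d))" if "c \<noteq> d" for c d
  proof -
    from that have "\<exists>k. c k \<noteq> d k"
      by (simp add: fun_eq_iff)
    then obtain k where k: "c k \<noteq> d k" "\<And>i. i < k \<Longrightarrow> c i = d i"
      using exists_least_iff[of "\<lambda>k. c k \<noteq> d k"] by blast
    have zero: "g j (c, d) = 0" if "j \<notin> {..k}" for j
    proof -
      have "(c, d) \<notin> agree j"
        using that k(1) by (auto simp: agree_def not_le)
      then show ?thesis
        by (simp add: g_def)
    qed
    have less: "g j (c, d) = ennreal (q ^ j * (a + b))" if "j < k" for j
      using that k nonneg by (auto simp: g_def agree_def facing_def indicator_def distrib_left simp flip: ennreal_plus)
    have self: "g k (c, d) = ennreal (q ^ k * a + (if c k = s then 0 else q ^ k * b))"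
      using k nonneg by (auto simp: g_def agree_def facing_def indicator_def simp flip: ennreal_plus)
    have "(\<Sum>k. g k (c, d)) = (\<Sum>j\<le>k. g j (c, d))"
      by (rule suminf_finite) (auto intro: zero)
    also have "\<dots> = (\<Sum>j<k. ennreal (q ^ j * (a + b))) + g k (c, d)"
      by (simp add: less flip: lessThan_Suc_atMost)
    also have "\<dots> = ennreal ((\<Sum>j<k. q ^ j * (a + b)) + (q ^ k * a + (if c k = s then 0 else q ^ k * b)))"
      unfolding self using nonneg by (subst ennreal_plus) (auto intro!: sum_nonneg)
    also have "\<dots> = T c d"
      by (subst T[where k = k]) (simp_all add: k add.assoc)
    finally show ?thesis ..
  qed
  have "(\<integral>\<^sup>+ (c, d). T c d \<partial>?M) = (\<integral>\<^sup>+ p. (\<Sum>k. g k p) \<partial>?M)"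
    by (rule nn_integral_cong_AE) (use AE_differ in eventually_elim, auto simp: T_eq)
  also have "\<dots> = (\<Sum>k. \<integral>\<^sup>+ p. g k p \<partial>?M)"
    by (rule nn_integral_suminf) (rule g_meas)
  also have "\<dots> = (\<Sum>k. ennreal ((q / 2) ^ k * (a + 3/4 * b)))"
  proof (rule suminf_cong)
    fix k
    \<comment> \<open>Facing has a quarter of the probability of agreement so far, which is the
      source of the factor 3/4.\<close>
    have "facing s k \<subseteq> agree k"
      by (auto simp: facing_def agree_def)
    then have "emeasure ?M (agree k - facing s k) = ennreal ((1/2) ^ k) - ennreal ((1/2) ^ k / 4)"
      by (subst emeasure_Diff) (simp_all add: emeasure_agree emeasure_facing sets_agree sets_facing)
    also have "\<dots> = ennreal ((1/2) ^ k * (3/4))"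
      by (simp add: ennreal_minus)
    finally have "(\<integral>\<^sup>+ p. g k p \<partial>?M) = ennreal (q ^ k * a) * ennreal ((1/2) ^ k) + ennreal (q ^ k * b) * ennreal ((1/2) ^ k * (3/4))"
      unfolding g_def by (subst nn_integral_add) (simp_all add: nn_integral_cmult_indicator emeasure_agree)
    also have "\<dots> = ennreal ((q / 2) ^ k * (a + 3/4 * b))"
      using nonneg by (simp add: power_divide field_simps flip: ennreal_mult ennreal_plus)
    finally show "(\<integral>\<^sup>+ p. g k p \<partial>?M) = ennreal ((q / 2) ^ k * (a + 3/4 * b))" .
  qed
  also have "\<dots> = ennreal ((a + 3/4 * b) / (1 - q / 2))"
  proof (rule suminf_ennreal_eq)
    \<comment> \<open>The probability of agreement halves per round while the lengths scale by
      \<open>q\<close>; \<open>q < 2\<close> makes the geometric series converge.\<close>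
    show "(\<lambda>k. (q / 2) ^ k * (a + 3/4 * b)) sums ((a + 3/4 * b) / (1 - q / 2))"
      using sums_mult2[OF geometric_sums[of "q / 2"], of "a + 3/4 * b"] nonneg by simp
  qed (use nonneg in auto)
  finally show ?thesis .
qed

subsection \<open>Expected meeting time\<close>

text \<open>The quotients are \<open>stretch 0\<close>, \<open>scale 0 * stretch 1\<close> and
  \<open>scale 0 * scale 1\<close> of \<open>darting\<close>, spelled out so that the formula can be
  analysed as \<rho> varies.\<close>

definition mean_time :: "real \<Rightarrow> real \<Rightarrow> real \<Rightarrow> real \<Rightarrow> real" where
  "mean_time \<rho> \<alpha> \<beta> \<gamma> =
     \<rho> * (sin \<alpha> / sin (\<alpha> + \<beta>) + 3/4 * (sin \<beta> / sin (\<alpha> + \<beta>) * (sin (2 * \<alpha>) / sin (2 * \<alpha> + \<gamma>))))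
     / (1 - sin \<beta> / sin (\<alpha> + \<beta>) * (sin \<gamma> / sin (2 * \<alpha> + \<gamma>)) / 2)"


context darting
begin

text \<open>Brings the arrival times into the shape expected by
  \<open>nn_integral_round_time\<close>, with \<open>q = scale 0 * scale 1\<close>,
  \<open>a = norm A * stretch 0\<close> and \<open>b = norm A * scale 0 * stretch 1\<close>.\<close>

lemma meeting_time_round:
  assumes A: "A \<noteq> 0" and agree: "\<And>i. i < k \<Longrightarrow> c i = d i" and differ: "c k \<noteq> d k"
  shows "meeting_time (waypoint \<alpha> \<beta> \<gamma> A c) (waypoint \<alpha> \<beta> \<gamma> (A * cis (2 * \<alpha>)) d) =
    ennreal ((\<Sum>j<k. (scale 0 * scale 1) ^ j * (norm A * stretch 0 + norm A * scale 0 * stretch 1))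
      + (scale 0 * scale 1) ^ k * (norm A * stretch 0)
      + (if c k then 0 else (scale 0 * scale 1) ^ k * (norm A * scale 0 * stretch 1)))"
proof -
  have even: "arrival_time (waypoint \<alpha> \<beta> \<gamma> A c) (2 * n) =
      (\<Sum>j<n. (scale 0 * scale 1) ^ j * (norm A * stretch 0 + norm A * scale 0 * stretch 1))" for n
    unfolding arrival_time_even(1)[OF A] by (simp add: algebra_simps)
  let ?S = "\<Sum>j<k. (scale 0 * scale 1) ^ j * (norm A * stretch 0 + norm A * scale 0 * stretch 1)"
  have facing: "arrival_time (waypoint \<alpha> \<beta> \<gamma> A c) (2 * k + 1) = ?S + (scale 0 * scale 1) ^ k * (norm A * stretch 0)"
    unfolding arrival_time_even(2)[OF A] even by simp
  have averted: "arrival_time (waypoint \<alpha> \<beta> \<gamma> A c) (2 * k + 2) = ?S + (scale 0 * scale 1) ^ k * (norm A * stretch 0)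
      + (scale 0 * scale 1) ^ k * (norm A * scale 0 * stretch 1)"
    using even[of "Suc k"] by (simp add: distrib_left)
  have "meeting_time (waypoint \<alpha> \<beta> \<gamma> A c) (waypoint \<alpha> \<beta> \<gamma> (A * cis (2 * \<alpha>)) d)
      = ennreal (arrival_time (waypoint \<alpha> \<beta> \<gamma> A c) (if c k then 2 * k + 1 else 2 * k + 2))"
    using A agree differ by (rule meeting_time_waypoint)
  then show ?thesis
    by (cases "c k") (simp_all only: facing averted if_True if_False add_0_right)
qed

lemma expected_meeting_time:
  assumes A: "A \<noteq> 0" and B: "B = A * cis (2 * \<alpha>) \<or> A = B * cis (2 * \<alpha>)"
    and conv: "scale 0 * scale 1 < 2"
  shows "(\<integral>\<^sup>+ (c, d). meeting_time (waypoint \<alpha> \<beta> \<gamma> A c) (waypoint \<alpha> \<beta> \<gamma> B d)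
    \<partial>(fair_coins \<Otimes>\<^sub>M fair_coins)) = ennreal (mean_time (norm A) \<alpha> \<beta> \<gamma>)"
    and mean_time_nonneg: "0 \<le> mean_time (norm A) \<alpha> \<beta> \<gamma>"
proof -
  have mean: "mean_time (norm A) \<alpha> \<beta> \<gamma> =
      (norm A * stretch 0 + 3/4 * (norm A * scale 0 * stretch 1)) / (1 - scale 0 * scale 1 / 2)"
    by (simp add: mean_time_def stretch_def scale_def turn_def incline_def algebra_simps)
  have nonneg: "0 \<le> norm A * stretch 0" "0 \<le> norm A * scale 0 * stretch 1" "0 \<le> scale 0 * scale 1"
    by (simp_all add: less_imp_le scale_pos stretch_pos)
  show "0 \<le> mean_time (norm A) \<alpha> \<beta> \<gamma>"
    unfolding mean using nonneg conv by (intro divide_nonneg_pos) auto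
  from B show "(\<integral>\<^sup>+ (c, d). meeting_time (waypoint \<alpha> \<beta> \<gamma> A c) (waypoint \<alpha> \<beta> \<gamma> B d)
    \<partial>(fair_coins \<Otimes>\<^sub>M fair_coins)) = ennreal (mean_time (norm A) \<alpha> \<beta> \<gamma>)" (is ?thesis)
  proof
    assume B: "B = A * cis (2 * \<alpha>)"
    show ?thesis
      unfolding mean B
    proof (rule nn_integral_round_time[OF nonneg conv, where s = True])
      fix c d :: "nat \<Rightarrow> bool" and k
      assume "\<And>i. i < k \<Longrightarrow> c i = d i" "c k \<noteq> d k"
      from meeting_time_round[where k = k and c = c and d = d, OF A this]
      show "meeting_time (waypoint \<alpha> \<beta> \<gamma> A c) (waypoint \<alpha> \<beta> \<gamma> (A * cis (2 * \<alpha>)) d) =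
        ennreal ((\<Sum>j<k. (scale 0 * scale 1) ^ j * (norm A * stretch 0 + norm A * scale 0 * stretch 1))
          + (scale 0 * scale 1) ^ k * (norm A * stretch 0)
          + (if c k = True then 0 else (scale 0 * scale 1) ^ k * (norm A * scale 0 * stretch 1)))"
        by simp
    qed
  next
    \<comment> \<open>Now the second robot is behind: symmetry of \<open>meeting_time\<close>
      exchanges the roles, and the outcome leading the first robot towards the second becomes
      \<open>False\<close>.\<close>
    assume B: "A = B * cis (2 * \<alpha>)"
    then have "B \<noteq> 0" and norm_B: "norm B = norm A"
      using A by (auto simp: norm_mult)
    show ?thesis
      unfolding mean
    proof (rule nn_integral_round_time[OF nonneg conv, where s = False])
      fix c d :: "nat \<Rightarrow> bool" and k
      assume "\<And>i. i < k \<Longrightarrow> c i = d i" and differ: "c k \<noteq> d k"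
      then have "\<And>i. i < k \<Longrightarrow> d i = c i" "d k \<noteq> c k"
        by auto
      from meeting_time_round[where k = k and c = d and d = c, OF \<open>B \<noteq> 0\<close> this]
      show "meeting_time (waypoint \<alpha> \<beta> \<gamma> A c) (waypoint \<alpha> \<beta> \<gamma> B d) =
        ennreal ((\<Sum>j<k. (scale 0 * scale 1) ^ j * (norm A * stretch 0 + norm A * scale 0 * stretch 1))
          + (scale 0 * scale 1) ^ k * (norm A * stretch 0)
          + (if c k = False then 0 else (scale 0 * scale 1) ^ k * (norm A * scale 0 * stretch 1)))"
        unfolding B[symmetric] norm_B meeting_time_commute[of "waypoint \<alpha> \<beta> \<gamma> B d"] using differ by simp
    qed
  qed
qed

end

text \<open>The quotient \<open>z = B / A\<close> lies on the unit circle at distance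
  \<open>2 * sin \<alpha>\<close> from 1. This fixes its real part as
  \<open>cos (2 * \<alpha>)\<close> and its imaginary part up to sign.\<close>

lemma srd_instance_rotation:
  assumes "srd_instance \<rho> A B" "\<rho> > 0" "sin \<alpha> = 1 / \<rho>"
  shows "B = A * cis (2 * \<alpha>) \<or> A = B * cis (2 * \<alpha>)"
proof -
  have "A \<noteq> 0" and norm: "norm A = \<rho>" "norm B = \<rho>" "norm (A - B) = 2"
    using assms by (auto simp: srd_instance_def dist_norm)
  define z where "z = B / A"
  have B: "B = A * z"
    using \<open>A \<noteq> 0\<close> by (simp add: z_def)
  have "norm z = 1"
    using norm assms(2) by (simp add: z_def norm_divide)
  then have z1: "(Re z)\<^sup>2 + (Im z)\<^sup>2 = 1"
    using cmod_power2[of z] by simp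
  have "norm (1 - z) = 2 * sin \<alpha>"
  proof -
    have "\<rho> * norm (1 - z) = 2"
      using norm(3) norm_mult[of A "1 - z"] by (simp add: B norm(1) right_diff_distrib)
    also have "2 = \<rho> * (2 * sin \<alpha>)"
      using assms by simp
    finally show ?thesis
      using assms(2) by simp
  qed
  then have "(1 - Re z)\<^sup>2 + (Im z)\<^sup>2 = (2 * sin \<alpha>)\<^sup>2"
    using cmod_power2[of "1 - z"] by simp
  with z1 have Re: "Re z = cos (2 * \<alpha>)"
    unfolding cos_double_sin by (simp add: power2_eq_square algebra_simps)
  with z1 have "(Im z)\<^sup>2 = (sin (2 * \<alpha>))\<^sup>2"
    by (simp add: sin_squared_eq)
  then consider "z = cis (2 * \<alpha>)" | "z = cis (- (2 * \<alpha>))"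
    using Re by (auto simp: complex_eq_iff power2_eq_iff)
  then show ?thesis
    by cases (simp_all add: B mult.assoc cis_mult)
qed

subsection \<open>Asymptotics\<close>

lemma tendsto_0_of_ratio:
  fixes f a :: "'a \<Rightarrow> real"
  assumes "((\<lambda>x. f x / a x) \<longlongrightarrow> L) F" "(a \<longlongrightarrow> 0) F" "\<forall>\<^sub>F x in F. a x \<noteq> 0"
  shows "(f \<longlongrightarrow> 0) F"
proof -
  have "((\<lambda>x. f x / a x * a x) \<longlongrightarrow> L * 0) F"
    by (intro tendsto_intros assms)
  moreover have "\<forall>\<^sub>F x in F. f x / a x * a x = f x"
    using assms(3) by eventually_elim simp
  ultimately show ?thesis
    using Lim_transform_eventually by fastforce
qed

text \<open>Caratheodory's form \<open>g z = h z * z\<close> of the derivative avoids dividing by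
  \<open>f x\<close>, which may vanish.\<close>

lemma tendsto_compose_ratio:
  fixes f a :: "'a \<Rightarrow> real"
  assumes "(g has_real_derivative D) (at 0)" "g 0 = 0"
    and lim: "((\<lambda>x. f x / a x) \<longlongrightarrow> L) F" "(a \<longlongrightarrow> 0) F" and nz: "\<forall>\<^sub>F x in F. a x \<noteq> 0"
  shows "((\<lambda>x. g (f x) / a x) \<longlongrightarrow> D * L) F"
proof -
  obtain h where h: "\<And>z. g z = h z * z" "isCont h 0" "h 0 = D"
    using assms(1,2) by (auto simp: CARAT_DERIV)
  have "(f \<longlongrightarrow> 0) F"
    by (rule tendsto_0_of_ratio[OF lim nz])
  then have "((\<lambda>x. h (f x) * (f x / a x)) \<longlongrightarrow> h 0 * L) F"
    by (intro tendsto_intros lim isCont_tendsto_compose[OF h(2)])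
  then show ?thesis by (simp add: h)
qed

text \<open>The half-angle identity \<open>1 - cos y = 2 * (sin (y / 2))\<^sup>2\<close> reduces
  this to the square of a first-order limit.\<close>

lemma tendsto_one_minus_cos:
  fixes f a :: "'a \<Rightarrow> real"
  assumes "((\<lambda>x. f x / a x) \<longlongrightarrow> L) F" "(a \<longlongrightarrow> 0) F" "\<forall>\<^sub>F x in F. a x \<noteq> 0"
  shows "((\<lambda>x. (1 - cos (f x)) / (a x)\<^sup>2) \<longlongrightarrow> L\<^sup>2 / 2) F"
proof -
  have "((\<lambda>x. sin (f x / 2) / a x) \<longlongrightarrow> 1/2 * L) F"
    by (rule tendsto_compose_ratio[where g = "\<lambda>y. sin (y / 2)", OF _ _ assms])
      (auto intro!: derivative_eq_intros)
  then have "((\<lambda>x. 2 * (sin (f x / 2) / a x)\<^sup>2) \<longlongrightarrow> 2 * (1/2 * L)\<^sup>2) F"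
    by (intro tendsto_intros)
  also have "(\<lambda>x. 2 * (sin (f x / 2) / a x)\<^sup>2) = (\<lambda>x. (1 - cos (f x)) / (a x)\<^sup>2)"
    using cos_double_sin[of "f x / 2" for x] by (simp add: power_divide)
  finally show ?thesis
    by (simp add: power2_eq_square)
qed

section \<open>Limits of the two darting angles\<close>

definition tan_beta :: "real \<Rightarrow> real" where
  "tan_beta \<alpha> = (let v = (2 * cos \<alpha> - cos (2 * \<alpha>)) * (1 / sin (2 * \<alpha>)); D = 9/4 * (cos \<alpha>)\<^sup>2 - 1
    in (- v + sqrt (v\<^sup>2 - D * (5/4 - v\<^sup>2))) / D)"

lemma beta_bar_eq: "beta_bar \<rho> = arctan (tan_beta (arcsin (1 / \<rho>)))"
  by (simp add: beta_bar_def tan_beta_def Let_def)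

text \<open>As \<alpha> tends to 0, \<open>v\<close> behaves like \<open>1 / (2 * \<alpha>)\<close>
  and \<open>D\<close> tends to 5/4. The root is then about \<open>v * sqrt (1 + D)\<close>, that is
  \<open>3/2 * v\<close>, and the quotient about \<open>2/5 * v\<close>, which is
  \<open>1 / (5 * \<alpha>)\<close>.\<close>

lemma tan_beta_asymp: "((\<lambda>\<alpha>. \<alpha> * tan_beta \<alpha>) \<longlongrightarrow> 1/5) (at_right 0)"
  unfolding tan_beta_def Let_def
  by real_asymp (simp add: powr_half_sqrt real_sqrt_divide power2_eq_square)

definition srd_angle :: "real \<Rightarrow> real" where
  "srd_angle \<rho> = arcsin (1 / \<rho>)"

lemma srd_angle_pos: "\<rho> \<ge> 1 \<Longrightarrow> 0 < srd_angle \<rho>" 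
  unfolding srd_angle_def using arcsin_less_arcsin[of 0 "1 / \<rho>"] by simp

lemma sin_srd_angle: "\<rho> \<ge> 1 \<Longrightarrow> sin (srd_angle \<rho>) = 1 / \<rho>"
  unfolding srd_angle_def by (subst sin_arcsin) (auto simp: divide_simps)

lemma srd_angle_tendsto: "(srd_angle \<longlongrightarrow> 0) at_top"
proof -
  have "((\<lambda>\<rho>. arcsin (1 / \<rho>)) \<longlongrightarrow> arcsin (0::real)) at_top"
    by (intro isCont_tendsto_compose[of _ arcsin] isCont_arcsin) (simp, simp, real_asymp)
  then show ?thesis by (simp add: srd_angle_def[abs_def])
qed

lemma srd_angle_nonzero: "\<forall>\<^sub>F \<rho> in at_top. srd_angle \<rho> \<noteq> 0"
  using eventually_ge_at_top[of 1] by eventually_elim (use srd_angle_pos in fastforce)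

lemma srd_angle_at_right: "filterlim srd_angle (at_right 0) at_top"
  unfolding filterlim_at
proof
  show "\<forall>\<^sub>F \<rho> in at_top. srd_angle \<rho> \<in> {0<..} \<and> srd_angle \<rho> \<noteq> 0"
    using eventually_ge_at_top[of 1] by eventually_elim (use srd_angle_pos in fastforce)
qed (rule srd_angle_tendsto)

text \<open>For positive \<open>t\<close>, \<open>pi/2 - arctan t\<close> is
  \<open>arctan (inverse t)\<close>, and the inverse of \<open>tan_beta \<alpha>\<close> is
  asymptotically 5\<alpha>.\<close>

lemma beta_bar_ratio: "((\<lambda>\<rho>. (pi/2 - beta_bar \<rho>) / srd_angle \<rho>) \<longlongrightarrow> 5) at_top"
proof -
  have lim: "((\<lambda>\<rho>. srd_angle \<rho> * tan_beta (srd_angle \<rho>)) \<longlongrightarrow> 1/5) at_top"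
    using filterlim_compose[OF tan_beta_asymp srd_angle_at_right] .
  have "((\<lambda>\<rho>. inverse (srd_angle \<rho> * tan_beta (srd_angle \<rho>))) \<longlongrightarrow> inverse (1/5)) at_top"
    by (intro tendsto_intros lim) auto
  then have "((\<lambda>\<rho>. inverse (tan_beta (srd_angle \<rho>)) / srd_angle \<rho>) \<longlongrightarrow> 5) at_top"
    by (simp add: field_simps)
  then have "((\<lambda>\<rho>. arctan (inverse (tan_beta (srd_angle \<rho>))) / srd_angle \<rho>) \<longlongrightarrow> 1 * 5) at_top"
    by (intro tendsto_compose_ratio srd_angle_tendsto srd_angle_nonzero)
      (auto intro!: derivative_eq_intros)
  moreover have "\<forall>\<^sub>F \<rho> in at_top. arctan (inverse (tan_beta (srd_angle \<rho>))) / srd_angle \<rho>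
      = (pi/2 - beta_bar \<rho>) / srd_angle \<rho>"
    using order_tendstoD(1)[OF lim, of 0, simplified] eventually_ge_at_top[of 1]
  proof eventually_elim
    case (elim \<rho>)
    then have "tan_beta (srd_angle \<rho>) > 0"
      using srd_angle_pos[of \<rho>] by (simp add: zero_less_mult_iff)
    then show ?case
      using arctan_inverse[of "tan_beta (srd_angle \<rho>)"]
      by (simp add: beta_bar_eq srd_angle_def inverse_eq_divide)
  qed
  ultimately show ?thesis
    using Lim_transform_eventually by fastforce
qed

text \<open>With \<delta> for \<open>pi/2 - beta_bar \<rho>\<close>, the cosine in
  \<open>gamma_bar\<close> is \<open>sin (\<delta> - \<alpha>)\<close>, and
  \<open>pi/2 - arccos y = arcsin y\<close>. To first order the angle is therefore 4/3 times
  5\<alpha> - \<alpha>.\<close>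

lemma gamma_bar_ratio: "((\<lambda>\<rho>. (pi/2 - gamma_bar \<rho>) / srd_angle \<rho>) \<longlongrightarrow> 16/3) at_top"
proof -
  define \<delta> where "\<delta> \<rho> = pi/2 - beta_bar \<rho>" for \<rho>
  have "((\<lambda>\<rho>. \<delta> \<rho> / srd_angle \<rho> - 1) \<longlongrightarrow> 5 - 1) at_top"
    unfolding \<delta>_def by (intro tendsto_intros beta_bar_ratio)
  moreover have "\<forall>\<^sub>F \<rho> in at_top. \<delta> \<rho> / srd_angle \<rho> - 1 = (\<delta> \<rho> - srd_angle \<rho>) / srd_angle \<rho>"
    using srd_angle_nonzero by eventually_elim (simp add: diff_divide_distrib)
  ultimately have ratio: "((\<lambda>\<rho>. (\<delta> \<rho> - srd_angle \<rho>) / srd_angle \<rho>) \<longlongrightarrow> 4) at_top"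
    using Lim_transform_eventually by fastforce
  then have "((\<lambda>\<rho>. 4/3 * sin (\<delta> \<rho> - srd_angle \<rho>) / srd_angle \<rho>) \<longlongrightarrow> 4/3 * 4) at_top"
    by (intro tendsto_compose_ratio[where g = "\<lambda>y. 4/3 * sin y"] srd_angle_tendsto srd_angle_nonzero)
      (auto intro!: derivative_eq_intros)
  then have lim: "((\<lambda>\<rho>. arcsin (4/3 * sin (\<delta> \<rho> - srd_angle \<rho>)) / srd_angle \<rho>) \<longlongrightarrow> 1 * (4/3 * 4)) at_top"
    by (intro tendsto_compose_ratio[where g = arcsin] srd_angle_tendsto srd_angle_nonzero)
      (auto intro!: derivative_eq_intros)
  \<comment> \<open>Turning \<open>arccos\<close> into \<open>arcsin\<close> requires an argument
    between -1 and 1; it tends to 0.\<close>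
  have "((\<lambda>\<rho>. \<bar>4/3 * sin (\<delta> \<rho> - srd_angle \<rho>)\<bar>) \<longlongrightarrow> \<bar>4/3 * sin 0\<bar>) at_top"
    by (intro tendsto_intros tendsto_0_of_ratio[OF ratio srd_angle_tendsto srd_angle_nonzero])
  then have ev: "\<forall>\<^sub>F \<rho> in at_top. \<bar>4/3 * sin (\<delta> \<rho> - srd_angle \<rho>)\<bar> < 1"
    by (rule order_tendstoD(2)) simp
  have "\<forall>\<^sub>F \<rho> in at_top. arcsin (4/3 * sin (\<delta> \<rho> - srd_angle \<rho>)) / srd_angle \<rho>
      = (pi/2 - gamma_bar \<rho>) / srd_angle \<rho>"
    using ev
  proof eventually_elim
    case (elim \<rho>)
    have "sin (\<delta> \<rho> - srd_angle \<rho>) = cos (srd_angle \<rho> + beta_bar \<rho>)"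
      unfolding \<delta>_def cos_sin_eq by (simp add: algebra_simps)
    then show ?case
      using elim by (simp add: gamma_bar_def srd_angle_def arccos_arcsin_eq abs_le_iff)
  qed
  with lim show ?thesis
    using Lim_transform_eventually by fastforce
qed

section \<open>Second-order expansion of the mean time\<close>

lemma tendsto_ratio_shift:
  fixes f a :: "'a \<Rightarrow> real"
  assumes "((\<lambda>x. f x / a x) \<longlongrightarrow> L) F" "\<forall>\<^sub>F x in F. a x \<noteq> 0"
  shows "((\<lambda>x. (f x - m * a x) / a x) \<longlongrightarrow> L - m) F"
proof -
  have "((\<lambda>x. f x / a x - m) \<longlongrightarrow> L - m) F"
    by (intro tendsto_intros assms)
  moreover have "\<forall>\<^sub>F x in F. f x / a x - m = (f x - m * a x) / a x"
    using assms(2) by eventually_elim (simp add: diff_divide_distrib)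
  ultimately show ?thesis
    by (rule Lim_transform_eventually)
qed

text \<open>Each cosine is written as \<open>1 - \<alpha>\<^sup>2 * x\<close> with \<open>x\<close>
  one of the quotients \<open>a\<^sub>1\<close> to \<open>b\<^sub>2\<close>. The result is an exact
  identity whose right side consists of quantities with limits, so no remainder estimate
  arises.\<close>

lemma mean_time_deficit:
  fixes \<alpha> \<delta> \<eta> \<rho> :: real
  assumes "\<alpha> \<noteq> 0" "\<rho> * sin \<alpha> = 1" "cos (\<delta> - \<alpha>) \<noteq> 0" "cos (\<eta> - 2 * \<alpha>) \<noteq> 0"
    "cos (\<delta> - \<alpha>) * cos (\<eta> - 2 * \<alpha>) - cos \<delta> * cos \<eta> / 2 \<noteq> 0"
  defines "a\<^sub>1 \<equiv> (1 - cos (\<delta> - \<alpha>)) / \<alpha>\<^sup>2" and "a\<^sub>2 \<equiv> (1 - cos (\<eta> - 2 * \<alpha>)) / \<alpha>\<^sup>2"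
    and "b\<^sub>0 \<equiv> (1 - cos \<alpha>) / \<alpha>\<^sup>2" and "b\<^sub>1 \<equiv> (1 - cos \<delta>) / \<alpha>\<^sup>2" and "b\<^sub>2 \<equiv> (1 - cos \<eta>) / \<alpha>\<^sup>2"
  shows "\<rho>\<^sup>2 * (5 - mean_time \<rho> \<alpha> (pi/2 - \<delta>) (pi/2 - \<eta>)) =
    (5 * (\<alpha>\<^sup>2 * a\<^sub>1 * a\<^sub>2 - a\<^sub>1 - a\<^sub>2) - 5/2 * (\<alpha>\<^sup>2 * b\<^sub>1 * b\<^sub>2 - b\<^sub>1 - b\<^sub>2) + a\<^sub>2 + 3/2 * (b\<^sub>1 + b\<^sub>0 - \<alpha>\<^sup>2 * b\<^sub>1 * b\<^sub>0))
    / ((1 - \<alpha>\<^sup>2 * a\<^sub>1) * (1 - \<alpha>\<^sup>2 * a\<^sub>2) - (1 - \<alpha>\<^sup>2 * b\<^sub>1) * (1 - \<alpha>\<^sup>2 * b\<^sub>2) / 2) / (sin \<alpha> / \<alpha>)\<^sup>2"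
proof -
  define C\<^sub>1 C\<^sub>2 c\<^sub>0 c\<^sub>1 c\<^sub>2 where C: "C\<^sub>1 = cos (\<delta> - \<alpha>)" "C\<^sub>2 = cos (\<eta> - 2 * \<alpha>)" "c\<^sub>0 = cos \<alpha>" "c\<^sub>1 = cos \<delta>" "c\<^sub>2 = cos \<eta>"
  have sin: "sin (\<alpha> + (pi/2 - \<delta>)) = C\<^sub>1" "sin (2 * \<alpha> + (pi/2 - \<eta>)) = C\<^sub>2" "sin (pi/2 - \<delta>) = c\<^sub>1" "sin (pi/2 - \<eta>) = c\<^sub>2"
    unfolding C by (simp_all add: sin_cos_eq algebra_simps)
  have expand: "C\<^sub>1 = 1 - \<alpha>\<^sup>2 * a\<^sub>1" "C\<^sub>2 = 1 - \<alpha>\<^sup>2 * a\<^sub>2" "c\<^sub>0 = 1 - \<alpha>\<^sup>2 * b\<^sub>0" "c\<^sub>1 = 1 - \<alpha>\<^sup>2 * b\<^sub>1" "c\<^sub>2 = 1 - \<alpha>\<^sup>2 * b\<^sub>2"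
    using assms(1) by (simp_all add: C a\<^sub>1_def a\<^sub>2_def b\<^sub>0_def b\<^sub>1_def b\<^sub>2_def)
  define E where "E = C\<^sub>1 * C\<^sub>2 - c\<^sub>1 * c\<^sub>2 / 2"
  have nz: "C\<^sub>1 \<noteq> 0" "C\<^sub>2 \<noteq> 0" "E \<noteq> 0"
    using assms(3-5) by (simp_all add: C E_def)
  have "\<rho> * sin (2 * \<alpha>) = 2 * c\<^sub>0"
    using assms(2) unfolding sin_double C by algebra
  have num: "\<rho> * (sin \<alpha> / C\<^sub>1 + 3/4 * (c\<^sub>1 / C\<^sub>1 * (sin (2 * \<alpha>) / C\<^sub>2))) = (C\<^sub>2 + 3/2 * c\<^sub>1 * c\<^sub>0) / (C\<^sub>1 * C\<^sub>2)"
  proof -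
    have "\<rho> * (sin \<alpha> / C\<^sub>1 + 3/4 * (c\<^sub>1 / C\<^sub>1 * (sin (2 * \<alpha>) / C\<^sub>2)))
        = ((\<rho> * sin \<alpha>) * C\<^sub>2 + 3/4 * c\<^sub>1 * (\<rho> * sin (2 * \<alpha>))) / (C\<^sub>1 * C\<^sub>2)"
      using nz by (simp add: field_simps)
    also have "\<dots> = (C\<^sub>2 + 3/2 * c\<^sub>1 * c\<^sub>0) / (C\<^sub>1 * C\<^sub>2)"
      unfolding assms(2) \<open>\<rho> * sin (2 * \<alpha>) = 2 * c\<^sub>0\<close> by simp
    finally show ?thesis .
  qed
  have den: "1 - c\<^sub>1 / C\<^sub>1 * (c\<^sub>2 / C\<^sub>2) / 2 = E / (C\<^sub>1 * C\<^sub>2)"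
    using nz by (simp add: E_def field_simps)
  have "mean_time \<rho> \<alpha> (pi/2 - \<delta>) (pi/2 - \<eta>) = (C\<^sub>2 + 3/2 * c\<^sub>1 * c\<^sub>0) / E"
    unfolding mean_time_def sin num den using nz by simp
  then have "5 - mean_time \<rho> \<alpha> (pi/2 - \<delta>) (pi/2 - \<eta>) = (5 * E - C\<^sub>2 - 3/2 * c\<^sub>1 * c\<^sub>0) / E"
    using nz by (simp add: field_simps)
  \<comment> \<open>The constant terms cancel, \<open>5 * (1 - 1/2) - 1 - 3/2 = 0\<close>, so a
    factor \<open>\<alpha>\<^sup>2\<close> splits off; it offsets
    \<open>\<rho>\<^sup>2\<close>.\<close>
  also have "5 * E - C\<^sub>2 - 3/2 * c\<^sub>1 * c\<^sub>0 = \<alpha>\<^sup>2 *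
    (5 * (\<alpha>\<^sup>2 * a\<^sub>1 * a\<^sub>2 - a\<^sub>1 - a\<^sub>2) - 5/2 * (\<alpha>\<^sup>2 * b\<^sub>1 * b\<^sub>2 - b\<^sub>1 - b\<^sub>2) + a\<^sub>2 + 3/2 * (b\<^sub>1 + b\<^sub>0 - \<alpha>\<^sup>2 * b\<^sub>1 * b\<^sub>0))"
    unfolding E_def expand by (simp add: field_simps)
  finally have deficit: "5 - mean_time \<rho> \<alpha> (pi/2 - \<delta>) (pi/2 - \<eta>) = \<alpha>\<^sup>2 *
    (5 * (\<alpha>\<^sup>2 * a\<^sub>1 * a\<^sub>2 - a\<^sub>1 - a\<^sub>2) - 5/2 * (\<alpha>\<^sup>2 * b\<^sub>1 * b\<^sub>2 - b\<^sub>1 - b\<^sub>2) + a\<^sub>2 + 3/2 * (b\<^sub>1 + b\<^sub>0 - \<alpha>\<^sup>2 * b\<^sub>1 * b\<^sub>0)) / E"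
    (is "_ = \<alpha>\<^sup>2 * ?num / E") .
  have scale: "\<rho>\<^sup>2 * \<alpha>\<^sup>2 = 1 / (sin \<alpha> / \<alpha>)\<^sup>2"
  proof -
    have "\<rho> = 1 / sin \<alpha>"
      using assms(2) by (metis nonzero_eq_divide_eq mult_zero_right zero_neq_one)
    then show ?thesis by (simp add: power_divide)
  qed
  have "\<rho>\<^sup>2 * (\<alpha>\<^sup>2 * ?num / E) = (\<rho>\<^sup>2 * \<alpha>\<^sup>2) * ?num / E"
    by (simp only: mult.assoc times_divide_eq_right)
  also have "\<dots> = ?num / E / (sin \<alpha> / \<alpha>)\<^sup>2"
    unfolding scale by (simp only: times_divide_eq_left mult_1 divide_divide_eq_left mult.commute)
  finally show ?thesis
    unfolding deficit unfolding E_def expand .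
qed

lemma mean_time_limit:
  "((\<lambda>\<rho>. \<rho>\<^sup>2 * (5 - mean_time \<rho> (srd_angle \<rho>) (beta_bar \<rho>) (gamma_bar \<rho>))) \<longlongrightarrow> 289/6) at_top"
proof -
  define \<delta> where "\<delta> \<rho> = pi/2 - beta_bar \<rho>" for \<rho>
  define \<eta> where "\<eta> \<rho> = pi/2 - gamma_bar \<rho>" for \<rho>
  define q where "q f \<rho> = (1 - cos (f \<rho>)) / (srd_angle \<rho>)\<^sup>2" for f :: "real \<Rightarrow> real" and \<rho>
  note small = srd_angle_tendsto srd_angle_nonzero
  define \<delta>' where "\<delta>' \<rho> = \<delta> \<rho> - srd_angle \<rho>" for \<rho>
  define \<eta>' where "\<eta>' \<rho> = \<eta> \<rho> - 2 * srd_angle \<rho>" for \<rho>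
  have ratio: "((\<lambda>\<rho>. \<delta> \<rho> / srd_angle \<rho>) \<longlongrightarrow> 5) at_top" "((\<lambda>\<rho>. \<eta> \<rho> / srd_angle \<rho>) \<longlongrightarrow> 16/3) at_top"
    unfolding \<delta>_def \<eta>_def by (rule beta_bar_ratio gamma_bar_ratio)+
  have ratio': "((\<lambda>\<rho>. \<delta>' \<rho> / srd_angle \<rho>) \<longlongrightarrow> 4) at_top" "((\<lambda>\<rho>. \<eta>' \<rho> / srd_angle \<rho>) \<longlongrightarrow> 10/3) at_top"
    using tendsto_ratio_shift[OF ratio(1) small(2), of 1] tendsto_ratio_shift[OF ratio(2) small(2), of 2]
    by (simp_all add: \<delta>'_def \<eta>'_def)
  have self: "((\<lambda>\<rho>. srd_angle \<rho> / srd_angle \<rho>) \<longlongrightarrow> 1) at_top"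
    by (rule tendsto_eventually) (use small(2) in eventually_elim, auto)
  have q: "(q srd_angle \<longlongrightarrow> 1\<^sup>2 / 2) at_top" "(q \<delta> \<longlongrightarrow> 5\<^sup>2 / 2) at_top" "(q \<eta> \<longlongrightarrow> (16/3)\<^sup>2 / 2) at_top"
    "(q \<delta>' \<longlongrightarrow> 4\<^sup>2 / 2) at_top" "(q \<eta>' \<longlongrightarrow> (10/3)\<^sup>2 / 2) at_top"
    unfolding q_def by (intro tendsto_one_minus_cos ratio ratio' self small)+
  have sinc: "((\<lambda>\<rho>. sin (srd_angle \<rho>) / srd_angle \<rho>) \<longlongrightarrow> 1 * 1) at_top"
    by (rule tendsto_compose_ratio[OF _ _ self small]) (auto intro!: derivative_eq_intros)
  have cos: "((\<lambda>\<rho>. cos (f \<rho>)) \<longlongrightarrow> cos 0) at_top" if "((\<lambda>\<rho>. f \<rho> / srd_angle \<rho>) \<longlongrightarrow> L) at_top" for f L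
    by (intro tendsto_cos tendsto_0_of_ratio[OF that small])
  let ?num = "\<lambda>\<alpha> a\<^sub>1 a\<^sub>2 b\<^sub>0 b\<^sub>1 b\<^sub>2 :: real. 5 * (\<alpha>\<^sup>2 * a\<^sub>1 * a\<^sub>2 - a\<^sub>1 - a\<^sub>2) - 5/2 * (\<alpha>\<^sup>2 * b\<^sub>1 * b\<^sub>2 - b\<^sub>1 - b\<^sub>2)
    + a\<^sub>2 + 3/2 * (b\<^sub>1 + b\<^sub>0 - \<alpha>\<^sup>2 * b\<^sub>1 * b\<^sub>0)"
  let ?den = "\<lambda>\<alpha> a\<^sub>1 a\<^sub>2 b\<^sub>1 b\<^sub>2 :: real. (1 - \<alpha>\<^sup>2 * a\<^sub>1) * (1 - \<alpha>\<^sup>2 * a\<^sub>2) - (1 - \<alpha>\<^sup>2 * b\<^sub>1) * (1 - \<alpha>\<^sup>2 * b\<^sub>2) / 2"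
  \<comment> \<open>The ratios to \<alpha> tend to 1, 5, 16/3, 4 and 10/3, and each
    \<open>1 - cos\<close> contributes half the square. The numerator tends to 289/12 and the
    denominator to 1/2.\<close>
  have "((\<lambda>\<rho>. ?num (srd_angle \<rho>) (q \<delta>' \<rho>) (q \<eta>' \<rho>) (q srd_angle \<rho>) (q \<delta> \<rho>) (q \<eta> \<rho>) /
      ?den (srd_angle \<rho>) (q \<delta>' \<rho>) (q \<eta>' \<rho>) (q \<delta> \<rho>) (q \<eta> \<rho>) / (sin (srd_angle \<rho>) / srd_angle \<rho>)\<^sup>2)
    \<longlongrightarrow> ?num 0 (4\<^sup>2 / 2) ((10/3)\<^sup>2 / 2) (1\<^sup>2 / 2) (5\<^sup>2 / 2) ((16/3)\<^sup>2 / 2) /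
      ?den 0 (4\<^sup>2 / 2) ((10/3)\<^sup>2 / 2) (5\<^sup>2 / 2) ((16/3)\<^sup>2 / 2) / (1 * 1)\<^sup>2) at_top"
    by (intro tendsto_intros q sinc srd_angle_tendsto) auto
  then have lim: "((\<lambda>\<rho>. ?num (srd_angle \<rho>) (q \<delta>' \<rho>) (q \<eta>' \<rho>) (q srd_angle \<rho>) (q \<delta> \<rho>) (q \<eta> \<rho>) /
      ?den (srd_angle \<rho>) (q \<delta>' \<rho>) (q \<eta>' \<rho>) (q \<delta> \<rho>) (q \<eta> \<rho>) / (sin (srd_angle \<rho>) / srd_angle \<rho>)\<^sup>2)
    \<longlongrightarrow> 289/6) at_top"
    by (simp add: power_divide)
  have "((\<lambda>\<rho>. cos (\<delta>' \<rho>) * cos (\<eta>' \<rho>) - cos (\<delta> \<rho>) * cos (\<eta> \<rho>) / 2) \<longlongrightarrow> cos 0 * cos 0 - cos 0 * cos 0 / 2) at_top"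
    by (intro tendsto_diff tendsto_mult tendsto_divide tendsto_const
      cos[OF ratio(1)] cos[OF ratio(2)] cos[OF ratio'(1)] cos[OF ratio'(2)]) simp
  then have den: "\<forall>\<^sub>F \<rho> in at_top. cos (\<delta>' \<rho>) * cos (\<eta>' \<rho>) - cos (\<delta> \<rho>) * cos (\<eta> \<rho>) / 2 > 0"
    by (rule order_tendstoD(1)) simp
  have pos: "\<forall>\<^sub>F \<rho> in at_top. cos (\<delta>' \<rho>) > 0" "\<forall>\<^sub>F \<rho> in at_top. cos (\<eta>' \<rho>) > 0"
    using order_tendstoD(1)[OF cos[OF ratio'(1)], of 0] order_tendstoD(1)[OF cos[OF ratio'(2)], of 0] by auto
  have "\<forall>\<^sub>F \<rho> in at_top. ?num (srd_angle \<rho>) (q \<delta>' \<rho>) (q \<eta>' \<rho>) (q srd_angle \<rho>) (q \<delta> \<rho>) (q \<eta> \<rho>) /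
      ?den (srd_angle \<rho>) (q \<delta>' \<rho>) (q \<eta>' \<rho>) (q \<delta> \<rho>) (q \<eta> \<rho>) / (sin (srd_angle \<rho>) / srd_angle \<rho>)\<^sup>2
    = \<rho>\<^sup>2 * (5 - mean_time \<rho> (srd_angle \<rho>) (beta_bar \<rho>) (gamma_bar \<rho>))"
    using den pos eventually_ge_at_top[of 1]
  proof eventually_elim
    case (elim \<rho>)
    have "beta_bar \<rho> = pi/2 - \<delta> \<rho>" "gamma_bar \<rho> = pi/2 - \<eta> \<rho>"
      by (simp_all add: \<delta>_def \<eta>_def)
    moreover have "srd_angle \<rho> \<noteq> 0" "\<rho> * sin (srd_angle \<rho>) = 1"
      using srd_angle_pos[of \<rho>] sin_srd_angle[of \<rho>] elim by auto
    ultimately show ?case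
      using elim mean_time_deficit[of "srd_angle \<rho>" \<rho> "\<delta> \<rho>" "\<eta> \<rho>"]
      unfolding q_def \<delta>'_def \<eta>'_def by simp
  qed
  with lim show ?thesis
    by (rule Lim_transform_eventually)
qed

section \<open>Transfer to the randomized algorithm for large \<rho>\<close>

lemma beta_bar_tendsto: "(beta_bar \<longlongrightarrow> pi/2) at_top"
  and gamma_bar_tendsto: "(gamma_bar \<longlongrightarrow> pi/2) at_top"
  using tendsto_diff[OF tendsto_const[of "pi/2"] tendsto_0_of_ratio[OF beta_bar_ratio srd_angle_tendsto srd_angle_nonzero]]
    tendsto_diff[OF tendsto_const[of "pi/2"] tendsto_0_of_ratio[OF gamma_bar_ratio srd_angle_tendsto srd_angle_nonzero]]
  by simp_all

text \<open>The limits 0, \<open>pi/2\<close>, \<open>pi/2\<close> of the three angles satisfy all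
  conditions strictly except \<open>0 < \<alpha>\<close>, which holds for \<rho> \<ge> 1.\<close>

lemma eventually_darting: "\<forall>\<^sub>F \<rho> in at_top. darting (srd_angle \<rho>) (beta_bar \<rho>) (gamma_bar \<rho>)"
proof -
  note lims = srd_angle_tendsto beta_bar_tendsto gamma_bar_tendsto
  have "((\<lambda>\<rho>. 2 * srd_angle \<rho>) \<longlongrightarrow> 2 * 0) at_top"
    "((\<lambda>\<rho>. srd_angle \<rho> + beta_bar \<rho>) \<longlongrightarrow> 0 + pi/2) at_top"
    "((\<lambda>\<rho>. 2 * srd_angle \<rho> + gamma_bar \<rho>) \<longlongrightarrow> 2 * 0 + pi/2) at_top"
    by (intro tendsto_intros lims)+
  from this[THEN order_tendstoD(2), of pi] lims(2,3)[THEN order_tendstoD(1), of 0]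
  have "\<forall>\<^sub>F \<rho> in at_top. 2 * srd_angle \<rho> < pi" "\<forall>\<^sub>F \<rho> in at_top. srd_angle \<rho> + beta_bar \<rho> < pi"
    "\<forall>\<^sub>F \<rho> in at_top. 2 * srd_angle \<rho> + gamma_bar \<rho> < pi"
    "\<forall>\<^sub>F \<rho> in at_top. 0 < beta_bar \<rho>" "\<forall>\<^sub>F \<rho> in at_top. 0 < gamma_bar \<rho>"
    by simp_all
  then show ?thesis
    using eventually_ge_at_top[of 1]
    by eventually_elim (simp add: darting_def srd_angle_pos)
qed

text \<open>Convergence needs \<open>scale 0 * scale 1 < 2\<close>, which holds eventually because
  the product tends to 1. Nonnegativity is recorded so that \<open>enn2ereal\<close> later undoes
  \<open>ennreal\<close>, which sends negative reals to 0.\<close>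

lemma eventually_expected_rendezvous_time:
  fixes A B :: "real \<Rightarrow> complex"
  assumes inst: "\<And>\<rho>. \<rho> \<ge> r \<Longrightarrow> srd_instance \<rho> (A \<rho>) (B \<rho>)"
  shows "\<forall>\<^sub>F \<rho> in at_top. expected_rendezvous_time \<rho> (beta_bar \<rho>) (gamma_bar \<rho>) (A \<rho>) (B \<rho>)
    = ennreal (mean_time \<rho> (srd_angle \<rho>) (beta_bar \<rho>) (gamma_bar \<rho>)) \<and>
      0 \<le> mean_time \<rho> (srd_angle \<rho>) (beta_bar \<rho>) (gamma_bar \<rho>)"
proof -
  note lims = srd_angle_tendsto beta_bar_tendsto gamma_bar_tendsto
  have "((\<lambda>\<rho>. sin (beta_bar \<rho>) / sin (srd_angle \<rho> + beta_bar \<rho>) *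
      (sin (gamma_bar \<rho>) / sin (2 * srd_angle \<rho> + gamma_bar \<rho>)))
    \<longlongrightarrow> sin (pi/2) / sin (0 + pi/2) * (sin (pi/2) / sin (2 * 0 + pi/2))) at_top"
    by (intro tendsto_intros lims) auto
  then have "\<forall>\<^sub>F \<rho> in at_top. sin (beta_bar \<rho>) / sin (srd_angle \<rho> + beta_bar \<rho>) *
      (sin (gamma_bar \<rho>) / sin (2 * srd_angle \<rho> + gamma_bar \<rho>)) < 2"
    by (rule order_tendstoD(2)) simp
  then show ?thesis
    using eventually_darting eventually_ge_at_top[of r] eventually_ge_at_top[of 1]
  proof eventually_elim
    case (elim \<rho>)
    then interpret darting "srd_angle \<rho>" "beta_bar \<rho>" "gamma_bar \<rho>"
      by simp
    have \<rho>: "norm (A \<rho>) = \<rho>"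
      using inst elim by (simp add: srd_instance_def)
    then have "A \<rho> \<noteq> 0"
      using elim by auto
    moreover have "B \<rho> = A \<rho> * cis (2 * srd_angle \<rho>) \<or> A \<rho> = B \<rho> * cis (2 * srd_angle \<rho>)"
      using inst elim by (intro srd_instance_rotation[of \<rho>]) (auto simp: sin_srd_angle)
    moreover have "scale 0 * scale 1 < 2"
      using elim by (simp add: scale_def turn_def incline_def)
    ultimately show ?case
      unfolding expected_rendezvous_time_def srd_angle_def[symmetric]
      using expected_meeting_time[of "A \<rho>" "B \<rho>"] mean_time_nonneg[of "A \<rho>" "B \<rho>"] by (simp add: \<rho>)
  qed
qed

text \<open>The third limit is taken in the extended reals since the expectation might a priori be
  infinite; \<open>A\<close> and \<open>B\<close> may pick any instance for each \<rho>, without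
  regularity in \<rho>.\<close>

theorem theorem6:
  fixes A B :: "real \<Rightarrow> complex"
  assumes "\<And>\<rho>. \<rho> \<ge> 1 / sin (1/2) \<Longrightarrow> srd_instance \<rho> (A \<rho>) (B \<rho>)"
  shows "((\<lambda>\<rho>. (pi/2 - beta_bar \<rho>) / arcsin (1 / \<rho>)) \<longlongrightarrow> 5) at_top \<and>
         ((\<lambda>\<rho>. (pi/2 - gamma_bar \<rho>) / arcsin (1 / \<rho>)) \<longlongrightarrow> 16/3) at_top \<and>
         ((\<lambda>\<rho>. ereal (\<rho>\<^sup>2) *
                 (5 - enn2ereal (expected_rendezvous_time \<rho> (beta_bar \<rho>) (gamma_bar \<rho>) (A \<rho>) (B \<rho>))))
            \<longlongrightarrow> ereal (289/6)) at_top"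
proof (intro conjI)
  show "((\<lambda>\<rho>. (pi/2 - beta_bar \<rho>) / arcsin (1 / \<rho>)) \<longlongrightarrow> 5) at_top"
    "((\<lambda>\<rho>. (pi/2 - gamma_bar \<rho>) / arcsin (1 / \<rho>)) \<longlongrightarrow> 16/3) at_top"
    using beta_bar_ratio gamma_bar_ratio by (simp_all add: srd_angle_def)
  let ?T = "\<lambda>\<rho>. mean_time \<rho> (srd_angle \<rho>) (beta_bar \<rho>) (gamma_bar \<rho>)"
  have "\<forall>\<^sub>F \<rho> in at_top. expected_rendezvous_time \<rho> (beta_bar \<rho>) (gamma_bar \<rho>) (A \<rho>) (B \<rho>) = ennreal (?T \<rho>)
      \<and> 0 \<le> ?T \<rho>"
    by (rule eventually_expected_rendezvous_time) (rule assms)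
  then have "\<forall>\<^sub>F \<rho> in at_top. ereal (\<rho>\<^sup>2 * (5 - ?T \<rho>)) = ereal (\<rho>\<^sup>2) *
      (5 - enn2ereal (expected_rendezvous_time \<rho> (beta_bar \<rho>) (gamma_bar \<rho>) (A \<rho>) (B \<rho>)))"
  proof eventually_elim
    case (elim \<rho>)
    then have "enn2ereal (expected_rendezvous_time \<rho> (beta_bar \<rho>) (gamma_bar \<rho>) (A \<rho>) (B \<rho>)) = ereal (?T \<rho>)"
      by (simp add: enn2ereal_ennreal)
    moreover have "(5::ereal) = ereal 5"
      by simp
    ultimately show ?case
      by (simp only: ereal_minus(1) times_ereal.simps(1))
  qed
  moreover have "((\<lambda>\<rho>. ereal (\<rho>\<^sup>2 * (5 - ?T \<rho>))) \<longlongrightarrow> ereal (289/6)) at_top"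
    using mean_time_limit by simp
  ultimately show "((\<lambda>\<rho>. ereal (\<rho>\<^sup>2) *
      (5 - enn2ereal (expected_rendezvous_time \<rho> (beta_bar \<rho>) (gamma_bar \<rho>) (A \<rho>) (B \<rho>))))
    \<longlongrightarrow> ereal (289/6)) at_top"
    by (rule Lim_transform_eventually[rotated])
qed

end
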